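(* The quartics $X_t$, $t\ne\infty$, and the threefold $\mathcal{X}_\infty$ are unirational.
   Context: The base field $\Bbbk$ is algebraically closed of characteristic zero. For $t\in\Bbbk$ the quartic threefold $X_t$ is given in the hyperplane $\mathbb{P}^4=\{x_1+\dots+x_6=0\}\subset\mathbb{P}^5$ by $\sum_{i=1}^6x_i^4-t\big(\sum_{i=1}^6x_i^2\big)^2=0$. The threefold $\mathcal{X}_\infty$ is given in the weighted projective space $\mathbb{P}(2,1^6)$ (coordinates $x_0$ of weight $2$, $x_1,\dots,x_6$ of weight $1$) by $\sum_{i\ge1}x_i=0$, $\sum_{i\ge1}x_i^2=0$, $x_0^2=\sum_{i\ge1}x_i^4-\frac14\big(\sum_{i\ge1}x_i^2\big)^2$; it is a double covering of the quadric $\{\sum x_i=\sum x_i^2=0\}\subset\mathbb{P}^5$. *)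

theory Defs
  imports
    "HOL-Analysis.Abstract_Topology"
    "HOL-Library.Poly_Mapping"
    "HOL-Computational_Algebra.Polynomial"
begin

section \<open>Multivariate polynomials\<close>

text \<open>A polynomial in variables indexed by \<^typ>\<open>nat\<close> is a finitely supported map from exponent
  vectors to coefficients.\<close>

type_synonym 'k mpol = "(nat \<Rightarrow>\<^sub>0 nat) \<Rightarrow>\<^sub>0 'k"

definition mpol_eval :: "'k::comm_semiring_1 mpol \<Rightarrow> (nat \<Rightarrow> 'k) \<Rightarrow> 'k" where
  "mpol_eval F x =
     (\<Sum>m\<in>Poly_Mapping.keys F.
        Poly_Mapping.lookup F m * (\<Prod>i\<in>Poly_Mapping.keys m. x i ^ Poly_Mapping.lookup m i))"

definition whomog :: "nat set \<Rightarrow> (nat \<Rightarrow> nat) \<Rightarrow> nat \<Rightarrow> 'k::comm_semiring_1 mpol set" where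
  "whomog I w d =
     {F. \<forall>m\<in>Poly_Mapping.keys F.
           Poly_Mapping.keys m \<subseteq> I \<and>
           (\<Sum>i\<in>Poly_Mapping.keys m. w i * Poly_Mapping.lookup m i) = d}"

section \<open>Weighted projective spaces\<close>

text \<open>For a finite index set \<open>I\<close> and positive weights \<open>w\<close>, the (closed) points of the weighted
  projective space with coordinates \<open>x\<^sub>i\<close> of weight \<open>w i\<close>, for \<open>i \<in> I\<close>, are the orbits of
  the action of the nonzero scalars on the nonzero vectors.  A vector is a function on \<^typ>\<open>nat\<close>
  that is zero outside \<open>I\<close>.\<close>

definition nonzero_vecs :: "nat set \<Rightarrow> (nat \<Rightarrow> 'k::field) set" where
  "nonzero_vecs I = {x. (\<forall>i. i \<notin> I \<longrightarrow> x i = 0) \<and> (\<exists>i\<in>I. x i \<noteq> 0)}"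

definition wscale :: "(nat \<Rightarrow> nat) \<Rightarrow> 'k::field \<Rightarrow> (nat \<Rightarrow> 'k) \<Rightarrow> nat \<Rightarrow> 'k" where
  "wscale w c x = (\<lambda>i. c ^ w i * x i)"

definition wproj_rel :: "nat set \<Rightarrow> (nat \<Rightarrow> nat) \<Rightarrow> ((nat \<Rightarrow> 'k::field) \<times> (nat \<Rightarrow> 'k)) set" where
  "wproj_rel I w = {(x, y). x \<in> nonzero_vecs I \<and> y \<in> nonzero_vecs I \<and> (\<exists>c. c \<noteq> 0 \<and> y = wscale w c x)}"

definition wproj :: "nat set \<Rightarrow> (nat \<Rightarrow> nat) \<Rightarrow> (nat \<Rightarrow> 'k::field) set set" where
  "wproj I w = nonzero_vecs I // wproj_rel I w"

definition zero_locus ::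
  "nat set \<Rightarrow> (nat \<Rightarrow> nat) \<Rightarrow> 'k::field mpol set \<Rightarrow> (nat \<Rightarrow> 'k) set set" where
  "zero_locus I w S = {p \<in> wproj I w. \<forall>F\<in>S. \<forall>x\<in>p. mpol_eval F x = 0}"

definition zariski :: "nat set \<Rightarrow> (nat \<Rightarrow> nat) \<Rightarrow> (nat \<Rightarrow> 'k::field) set topology" where
  "zariski I w =
     topology (\<lambda>U. \<exists>S \<subseteq> (\<Union>d. whomog I w d). U = wproj I w - zero_locus I w S)"

section \<open>Regular functions, morphisms, unirationality\<close>

text \<open>\<open>U\<close> is a locally closed subset of the weighted projective space, with the induced reduced
  structure.\<close>

definition regular_on ::
  "nat set \<Rightarrow> (nat \<Rightarrow> nat) \<Rightarrow> (nat \<Rightarrow> 'k::field) set set \<Rightarrow> ((nat \<Rightarrow> 'k) set \<Rightarrow> 'k) \<Rightarrow> bool" where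
  "regular_on I w U f \<longleftrightarrow>
     (\<forall>p\<in>U. \<exists>V d. \<exists>F \<in> whomog I w d. \<exists>G \<in> whomog I w d.
        openin (subtopology (zariski I w) U) V \<and> p \<in> V \<and>
        (\<forall>q\<in>V. \<forall>x\<in>q. mpol_eval G x \<noteq> 0 \<and> f q = mpol_eval F x / mpol_eval G x))"

definition morphism ::
  "nat set \<Rightarrow> (nat \<Rightarrow> nat) \<Rightarrow> (nat \<Rightarrow> 'k::field) set set \<Rightarrow>
   nat set \<Rightarrow> (nat \<Rightarrow> nat) \<Rightarrow> (nat \<Rightarrow> 'k) set set \<Rightarrow>
   ((nat \<Rightarrow> 'k) set \<Rightarrow> (nat \<Rightarrow> 'k) set) \<Rightarrow> bool" where
  "morphism I w U J v Y \<phi> \<longleftrightarrow>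
     continuous_map (subtopology (zariski I w) U) (subtopology (zariski J v) Y) \<phi> \<and>
     (\<forall>V f. openin (subtopology (zariski J v) Y) V \<longrightarrow> regular_on J v V f \<longrightarrow>
        regular_on I w {p \<in> U. \<phi> p \<in> V} (f \<circ> \<phi>))"

text \<open>\<open>X\<close> is unirational if for some \<open>n\<close> there is a dominant rational map from \<open>n\<close>-dimensional
  projective space to \<open>X\<close>.  A rational map is an equivalence class of morphisms defined on nonempty
  open subsets; it is given here by a representative.  Irreducibility of \<open>X\<close> is
  implied.\<close>

definition unirational ::
  "nat set \<Rightarrow> (nat \<Rightarrow> nat) \<Rightarrow> (nat \<Rightarrow> 'k::field) set set \<Rightarrow> bool" where
  "unirational J v X \<longleftrightarrow>
     (\<exists>n U \<phi>. openin (zariski {..n} (\<lambda>_. 1)) U \<and> U \<noteq> {} \<and>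
        morphism {..n} (\<lambda>_. 1) U J v X \<phi> \<and>
        (subtopology (zariski J v) X) closure_of (\<phi> ` U) = X)"

section \<open>The threefolds\<close>

definition weights_2_1 :: "nat \<Rightarrow> nat" where
  "weights_2_1 i = (if i = 0 then 2 else 1)"

definition quartic_X :: "'k::field \<Rightarrow> (nat \<Rightarrow> 'k) set set" where
  "quartic_X t =
     {p \<in> wproj {1..6} (\<lambda>_. 1). \<forall>x\<in>p.
        (\<Sum>i=1..6. x i) = 0 \<and>
        (\<Sum>i=1..6. x i ^ 4) - t * (\<Sum>i=1..6. x i ^ 2) ^ 2 = 0}"

definition X_infinity :: "(nat \<Rightarrow> 'k::field) set set" where
  "X_infinity =
     {p \<in> wproj {0..6} weights_2_1. \<forall>x\<in>p.
        (\<Sum>i=1..6. x i) = 0 \<and>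
        (\<Sum>i=1..6. x i ^ 2) = 0 \<and>
        x 0 ^ 2 = (\<Sum>i=1..6. x i ^ 4) - 1 / 4 * (\<Sum>i=1..6. x i ^ 2) ^ 2}"

section \<open>The Zariski topology is well defined\<close>

lemma mpol_eval_superset:
  assumes "finite A" "Poly_Mapping.keys F \<subseteq> A"
  shows "mpol_eval F x = (\<Sum>m\<in>A. Poly_Mapping.lookup F m * (\<Prod>i\<in>Poly_Mapping.keys m. x i ^ Poly_Mapping.lookup m i))"
  unfolding mpol_eval_def using assms
  by (intro sum.mono_neutral_left) (auto simp: in_keys_iff)

lemma mpol_eval_add: "mpol_eval (F + G) x = mpol_eval F x + mpol_eval G x"
proof -
  let ?A = "Poly_Mapping.keys F \<union> Poly_Mapping.keys G"
  have "Poly_Mapping.keys (F + G) \<subseteq> ?A" by (rule keys_add)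
  then show ?thesis
    using mpol_eval_superset[of ?A F x] mpol_eval_superset[of ?A G x]
      mpol_eval_superset[of ?A "F + G" x]
    by (simp add: lookup_add distrib_right sum.distrib)
qed

lemma mpol_eval_zero [simp]: "mpol_eval 0 x = 0"
  by (simp add: mpol_eval_def)

lemma mpol_eval_single:
  "mpol_eval (Poly_Mapping.single m a) x = a * (\<Prod>i\<in>Poly_Mapping.keys m. x i ^ Poly_Mapping.lookup m i)"
  by (subst mpol_eval_superset[of "{m}"]) auto

lemma monomial_add:
  fixes x :: "nat \<Rightarrow> 'k::comm_semiring_1" and m n :: "nat \<Rightarrow>\<^sub>0 nat"
  shows "(\<Prod>i\<in>Poly_Mapping.keys (m + n). x i ^ Poly_Mapping.lookup (m + n) i) =
     (\<Prod>i\<in>Poly_Mapping.keys m. x i ^ Poly_Mapping.lookup m i) * (\<Prod>i\<in>Poly_Mapping.keys n. x i ^ Poly_Mapping.lookup n i)"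
proof -
  let ?A = "Poly_Mapping.keys m \<union> Poly_Mapping.keys n"
  have *: "(\<Prod>i\<in>Poly_Mapping.keys k. x i ^ Poly_Mapping.lookup k i) = (\<Prod>i\<in>?A. x i ^ Poly_Mapping.lookup k i)"
    if "Poly_Mapping.keys k \<subseteq> ?A" for k :: "nat \<Rightarrow>\<^sub>0 nat"
    using that by (intro prod.mono_neutral_left) (auto simp: in_keys_iff)
  show ?thesis
    using *[of m] *[of n] *[of "m + n"] keys_add[of m n]
    by (simp add: lookup_add power_add prod.distrib)
qed

lemma mpol_induct [case_names zero single_add]:
  fixes F :: "'k::comm_semiring_1 mpol"
  assumes "P 0" and "\<And>m a G. P G \<Longrightarrow> P (Poly_Mapping.single m a + G)"
  shows "P F"
proof -
  have "P (\<Sum>m\<in>A. Poly_Mapping.single m (Poly_Mapping.lookup F m))" if "finite A" for A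
    using that by induction (auto simp: assms)
  moreover have "F = (\<Sum>m\<in>Poly_Mapping.keys F. Poly_Mapping.single m (Poly_Mapping.lookup F m))"
    by (rule poly_mapping_eqI)
      (auto simp: lookup_sum lookup_single when_def in_keys_iff)
  ultimately show ?thesis
    by (metis finite_keys)
qed

lemma mpol_eval_mult: "mpol_eval (F * G) x = mpol_eval F x * mpol_eval G x"
proof (induction F rule: mpol_induct)
  case (single_add m a F)
  have "mpol_eval (Poly_Mapping.single m a * G) x = mpol_eval (Poly_Mapping.single m a) x * mpol_eval G x"
    by (induction G rule: mpol_induct)
      (auto simp: distrib_left mpol_eval_add mult_single mpol_eval_single monomial_add mult_ac)
  with single_add show ?case
    by (simp add: distrib_right mpol_eval_add)
qed simp

lemma whomog_mult:
  assumes "F \<in> whomog I w d" "G \<in> whomog I w e"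
  shows "F * G \<in> whomog I w (d + e)"
  unfolding whomog_def mem_Collect_eq
proof (intro ballI)
  fix k assume "k \<in> Poly_Mapping.keys (F * G)"
  then obtain m n where k: "k = m + n" and m: "m \<in> Poly_Mapping.keys F" and n: "n \<in> Poly_Mapping.keys G"
    using keys_mult[of F G] by blast
  let ?A = "Poly_Mapping.keys m \<union> Poly_Mapping.keys n"
  have *: "(\<Sum>i\<in>Poly_Mapping.keys l. w i * Poly_Mapping.lookup l i) = (\<Sum>i\<in>?A. w i * Poly_Mapping.lookup l i)"
    if "Poly_Mapping.keys l \<subseteq> ?A" for l :: "nat \<Rightarrow>\<^sub>0 nat"
    using that by (intro sum.mono_neutral_left) (auto simp: in_keys_iff)
  show "Poly_Mapping.keys k \<subseteq> I \<and> (\<Sum>i\<in>Poly_Mapping.keys k. w i * Poly_Mapping.lookup k i) = d + e"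
  proof
    show "Poly_Mapping.keys k \<subseteq> I"
      using assms m n keys_add[of m n] by (fastforce simp: whomog_def k)
    have "(\<Sum>i\<in>Poly_Mapping.keys k. w i * Poly_Mapping.lookup k i) =
          (\<Sum>i\<in>?A. w i * Poly_Mapping.lookup m i) + (\<Sum>i\<in>?A. w i * Poly_Mapping.lookup n i)"
      using *[of k] keys_add[of m n] by (simp add: k lookup_add distrib_left sum.distrib)
    also have "\<dots> = d + e"
      using assms m n *[of m, symmetric] *[of n, symmetric] by (simp add: whomog_def)
    finally show "(\<Sum>i\<in>Poly_Mapping.keys k. w i * Poly_Mapping.lookup k i) = d + e" .
  qed
qed

lemma mpol_eval_wscale:
  assumes "F \<in> whomog I w d"
  shows "mpol_eval F (wscale w c x) = c ^ d * mpol_eval F x"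
proof -
  have "Poly_Mapping.lookup F m * (\<Prod>i\<in>Poly_Mapping.keys m. wscale w c x i ^ Poly_Mapping.lookup m i) =
        c ^ d * (Poly_Mapping.lookup F m * (\<Prod>i\<in>Poly_Mapping.keys m. x i ^ Poly_Mapping.lookup m i))"
    if "m \<in> Poly_Mapping.keys F" for m
  proof -
    have "(\<Prod>i\<in>Poly_Mapping.keys m. wscale w c x i ^ Poly_Mapping.lookup m i) =
          c ^ (\<Sum>i\<in>Poly_Mapping.keys m. w i * Poly_Mapping.lookup m i) *
          (\<Prod>i\<in>Poly_Mapping.keys m. x i ^ Poly_Mapping.lookup m i)"
      by (simp add: wscale_def power_mult_distrib prod.distrib power_mult power_sum)
    also have "(\<Sum>i\<in>Poly_Mapping.keys m. w i * Poly_Mapping.lookup m i) = d"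
      using that assms by (simp add: whomog_def)
    finally show ?thesis by (simp add: mult_ac)
  qed
  then show ?thesis
    unfolding mpol_eval_def sum_distrib_left by (rule sum.cong[OF refl])
qed

lemma equiv_wproj_rel:
  "equiv (nonzero_vecs I) (wproj_rel I w :: ((nat \<Rightarrow> 'k::field) \<times> (nat \<Rightarrow> 'k)) set)" (is "equiv ?V ?R")
proof (intro equivI)
  show "?R \<subseteq> ?V \<times> ?V"
    by (auto simp: wproj_rel_def)
  show "refl_on ?V ?R"
    by (auto simp: refl_on_def wproj_rel_def wscale_def intro!: exI[of _ 1])
  show "sym ?R"
  proof (intro symI)
    fix x y :: "nat \<Rightarrow> 'k" assume "(x, y) \<in> wproj_rel I w"
    then obtain c where c: "c \<noteq> 0" "y = wscale w c x" "x \<in> nonzero_vecs I" "y \<in> nonzero_vecs I"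
      by (auto simp: wproj_rel_def)
    then have "x = wscale w (inverse c) y"
      by (auto simp: wscale_def fun_eq_iff field_simps power_inverse)
    with c show "(y, x) \<in> wproj_rel I w"
      by (auto simp: wproj_rel_def intro!: exI[of _ "inverse c"])
  qed
  show "trans ?R"
  proof (intro transI)
    fix x y z :: "nat \<Rightarrow> 'k" assume "(x, y) \<in> wproj_rel I w" "(y, z) \<in> wproj_rel I w"
    then obtain b c where "c \<noteq> 0" "b \<noteq> 0" "y = wscale w c x" "z = wscale w b y"
        "x \<in> nonzero_vecs I" "z \<in> nonzero_vecs I"
      by (auto simp: wproj_rel_def)
    moreover from this have "z = wscale w (b * c) x"
      by (auto simp: wscale_def power_mult_distrib)
    ultimately show "(x, z) \<in> wproj_rel I w"
      by (auto simp: wproj_rel_def intro!: exI[of _ "b * c"])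
  qed
qed

lemma wproj_eval_zero_iff:
  assumes "p \<in> wproj I w" "x \<in> p" "y \<in> p" "F \<in> whomog I w d"
  shows "mpol_eval F x = 0 \<longleftrightarrow> mpol_eval F y = 0"
proof -
  have "(x, y) \<in> wproj_rel I w"
    using assms in_quotient_imp_in_rel[OF equiv_wproj_rel, of p I w x y] by (simp add: wproj_def)
  then obtain c where "c \<noteq> 0" "y = wscale w c x"
    by (auto simp: wproj_rel_def)
  then show ?thesis
    using mpol_eval_wscale[OF assms(4), of c x] by simp
qed

lemma zero_locus_Un:
  assumes S: "S \<subseteq> (\<Union>d. whomog I w d)" and T: "T \<subseteq> (\<Union>d. whomog I w d)"
  shows "zero_locus I w S \<union> zero_locus I w T = zero_locus I w ((\<lambda>(F, G). F * G) ` (S \<times> T))"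
proof (intro equalityI subsetI)
  fix p assume p: "p \<in> zero_locus I w ((\<lambda>(F, G). F * G) ` (S \<times> T))"
  show "p \<in> zero_locus I w S \<union> zero_locus I w T"
  proof (rule ccontr)
    assume "\<not> ?thesis"
    with p obtain F x G y where *: "F \<in> S" "x \<in> p" "mpol_eval F x \<noteq> 0" "G \<in> T" "y \<in> p" "mpol_eval G y \<noteq> 0"
      by (auto simp: zero_locus_def)
    with p have "mpol_eval G x = 0"
      by (fastforce simp: zero_locus_def mpol_eval_mult)
    moreover from * T obtain d where "G \<in> whomog I w d" by blast
    ultimately show False
      using * p wproj_eval_zero_iff[of p I w x y G d] by (auto simp: zero_locus_def)
  qed
qed (auto simp: zero_locus_def mpol_eval_mult)

lemma istopology_zariski:
  "istopology (\<lambda>U :: (nat \<Rightarrow> 'k::field) set set. \<exists>S \<subseteq> (\<Union>d. whomog I w d). U = wproj I w - zero_locus I w S)"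
  unfolding istopology_def
proof (intro conjI allI impI)
  fix U V :: "(nat \<Rightarrow> 'k) set set"
  let ?H = "\<Union>d. whomog I w d :: 'k mpol set"
  assume "\<exists>S \<subseteq> ?H. U = wproj I w - zero_locus I w S" "\<exists>S \<subseteq> ?H. V = wproj I w - zero_locus I w S"
  then obtain S T where S: "S \<subseteq> ?H" "U = wproj I w - zero_locus I w S"
    and T: "T \<subseteq> ?H" "V = wproj I w - zero_locus I w T"
    by (elim exE conjE)
  have "U \<inter> V = wproj I w - zero_locus I w ((\<lambda>(F, G). F * G) ` (S \<times> T))"
    by (simp only: S(2) T(2) zero_locus_Un[OF S(1) T(1), symmetric] Diff_Un)
  moreover have "(\<lambda>(F, G). F * G) ` (S \<times> T) \<subseteq> ?H"
  proof clarify
    fix F G assume "F \<in> S" "G \<in> T"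
    then obtain d e where "F \<in> whomog I w d" "G \<in> whomog I w e"
      using S(1) T(1) by blast
    then show "F * G \<in> ?H"
      using whomog_mult by (intro UN_I[of "d + e"]) auto
  qed
  ultimately show "\<exists>S \<subseteq> ?H. U \<inter> V = wproj I w - zero_locus I w S"
    by (intro exI conjI)
next
  fix \<K> :: "(nat \<Rightarrow> 'k) set set set"
  let ?H = "\<Union>d. whomog I w d :: 'k mpol set"
  assume "\<forall>K\<in>\<K>. \<exists>S \<subseteq> ?H. K = wproj I w - zero_locus I w S"
  then obtain f where f: "\<forall>K\<in>\<K>. f K \<subseteq> ?H \<and> K = wproj I w - zero_locus I w (f K)"
    unfolding bchoice_iff by (elim exE)
  then have "\<Union>\<K> = (\<Union>K\<in>\<K>. wproj I w - zero_locus I w (f K))"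
    by (intro equalityI subsetI; simp; blast)
  also have "\<dots> = wproj I w - zero_locus I w (\<Union>K\<in>\<K>. f K)"
    by (auto simp: zero_locus_def)
  finally have "\<Union>\<K> = wproj I w - zero_locus I w (\<Union>K\<in>\<K>. f K)" .
  moreover have "(\<Union>K\<in>\<K>. f K) \<subseteq> ?H"
    by (intro UN_least) (simp add: f)
  ultimately show "\<exists>S \<subseteq> ?H. \<Union>\<K> = wproj I w - zero_locus I w S"
    by (intro exI conjI)
qed

lemma openin_zariski:
  "openin (zariski I w) U \<longleftrightarrow> (\<exists>S \<subseteq> (\<Union>d. whomog I w d). U = wproj I w - zero_locus I w S)"
  by (simp add: zariski_def topology_inverse'[OF istopology_zariski])

lemma topspace_zariski [simp]: "topspace (zariski I w) = (wproj I w :: (nat \<Rightarrow> 'k::field) set set)"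
  (is "topspace ?Z = ?P")
proof (intro equalityI)
  show "topspace ?Z \<subseteq> ?P"
    unfolding topspace_def by (auto simp: openin_zariski)
  have "(1 :: 'k mpol) \<in> whomog I w 0"
    by (auto simp: whomog_def)
  moreover have "mpol_eval (1 :: 'k mpol) x = 1" for x
    using mpol_eval_single[of 0 1 x] by simp
  moreover have "p \<noteq> {}" if "p \<in> wproj I w" for p :: "(nat \<Rightarrow> 'k) set"
    using that in_quotient_imp_non_empty[OF equiv_wproj_rel] unfolding wproj_def by blast
  ultimately have "openin ?Z ?P"
    unfolding openin_zariski by (intro exI[of _ "{1}"]) (auto simp: zero_locus_def)
  then show "?P \<subseteq> topspace ?Z"
    by (rule openin_subset)
qed

lemma closedin_zariski:
  fixes Z :: "(nat \<Rightarrow> 'k::field) set set"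
  shows "closedin (zariski I w) Z \<longleftrightarrow> (\<exists>S \<subseteq> (\<Union>d. whomog I w d). Z = zero_locus I w S)"
proof -
  have "zero_locus I w S \<subseteq> wproj I w" for S :: "'k mpol set"
    by (auto simp: zero_locus_def)
  then show ?thesis
    unfolding closedin_def topspace_zariski openin_zariski
    by (metis Diff_Diff_Int inf.absorb_iff2 Diff_subset)
qed

end

theory Submission
  imports Defs "HOL-Library.Product_Plus"
begin

text \<open>The threefolds are members of one family on the Coble fourfold
\<open>x\<^sub>0\<^sup>2 = \<Sum> x\<^sub>i\<^sup>4 - 1/4 (\<Sum> x\<^sub>i\<^sup>2)\<^sup>2\<close>, \<open>\<Sum> x\<^sub>i = 0\<close>, the double cover of projective four-space
branched in the Igusa quartic.  Cutting it by \<open>l x\<^sub>0 = m \<Sum> x\<^sub>i\<^sup>2\<close> gives \<open>X\<^sub>t\<close> for \<open>l = 1\<close>,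
\<open>m\<^sup>2 = t - 1/4\<close> (eliminate \<open>x\<^sub>0\<close>), and the threefold at infinity for \<open>l = 0\<close>, \<open>m = 1\<close>.

The right-hand side of the Coble equation is the discriminant of a quadratic polynomial: translate
\<open>x\<^sub>1, x\<^sub>2, x\<^sub>3\<close> and \<open>x\<^sub>4, x\<^sub>5, x\<^sub>6\<close> suitably, and look for a common shift \<open>\<beta>\<close> that makes the products of
the two triples equal.  Hence the fourfold is birational to the cubic \<open>a\<^sub>1 a\<^sub>2 a\<^sub>3 = b\<^sub>1 b\<^sub>2 b\<^sub>3\<close> in
five-space, where \<open>x\<^sub>0\<close> becomes \<open>e\<^sub>2(a) - e\<^sub>2(b)\<close> up to scale.  The solutions \<open>a\<close>, \<open>b\<close> with nonzero
entries are the off-diagonal entries of the rank one matrices \<open>u\<^sub>i v\<^sub>j\<close>, so the fourfold is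
birational to the product of two planes (\<open>coble_recover\<close>), and the threefold becomes a divisor
\<open>biquad l m u v = 0\<close> of bidegree \<open>(2, 2)\<close>, a conic bundle over the plane of the \<open>u\<close>.

A conic bundle with a rational multisection is unirational.  The line \<open>v\<^sub>1 = 0\<close> cuts each conic in two
points, so the pairs \<open>(u, v\<^sub>0)\<close> with \<open>v\<^sub>0 = (0, p, q)\<close> on the conic over \<open>u\<close> form a double section.
For fixed \<open>(p, q)\<close> they form a conic in \<open>u\<close> which, with \<open>\<omega>\<close> a primitive cube root of unity, passes
through \<open>(0, -\<omega> p, q)\<close>; projection from this point parametrizes the double section
(\<open>parametrization_generic\<close>).  In two degenerate cases the double section splits and one of its
components is a section: \<open>m = 0\<close>, the Igusa quartic (\<open>parametrization_igusa\<close>), and \<open>l = 2 m\<close>, the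
Burkhardt quartic \<open>t = 1/2\<close> (\<open>parametrization_burkhardt\<close>).  Projecting the conic over \<open>u\<close> from
\<open>v\<^sub>0\<close> parametrizes the threefold.

That the image is dense rests on an elementary substitute for dimension theory: if a polynomial \<open>F\<close>
vanishes on a plane curve outside the fibres over finitely many values of the first coordinate, then \<open>F\<close>
vanishes at each point of the curve that does not lie on a vertical component
(\<open>vanishing_on_plane_curve\<close>).  It is applied twice: to curves in the cone over the
threefold, to restrict to points where all sums of three coordinates are nonzero
(\<open>quartic_cone_step\<close>, \<open>infinity_cone_step\<close>), and to curves in the divisor of bidegree \<open>(2, 2)\<close>, to
restrict to general \<open>u\<close> (\<open>\<Psi>_dense\<close>).  For such points a preimage is written down at once: the
directions of projection are the point itself (\<open>\<Psi>_hits\<close>).\<close>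

section \<open>Density along plane curves\<close>

text \<open>A polynomial in two variables \<open>s\<close>, \<open>z\<close> is a polynomial in \<open>z\<close> whose coefficients are polynomials in
\<open>s\<close>; its slice is the restriction to the vertical line over \<open>s\<close>.\<close>

definition slice :: "'k::field \<Rightarrow> 'k poly poly \<Rightarrow> 'k poly" where
  "slice s P = map_poly (\<lambda>c. poly c s) P"

lemma coeff_slice [simp]: "coeff (slice s P) i = poly (coeff P i) s"
  by (simp add: slice_def coeff_map_poly)

lemma poly_slice: "poly (slice s P) z = poly (poly P [:z:]) s"
  by (induction P) (simp_all add: slice_def map_poly_pCons)

lemma slice_simps:
  fixes s :: "'k::field_char_0"
  shows "slice s (P + Q) = slice s P + slice s Q" "slice s (P * Q) = slice s P * slice s Q"
    "slice s (P ^ n) = slice s P ^ n" "slice s (smult a P) = smult (poly a s) (slice s P)"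
  by (simp_all add: fun_eq_iff poly_slice flip: poly_eq_poly_eq_iff)

lemma poly_dvd_power_degree:
  fixes p f :: "'k::alg_closed_field poly"
  assumes "p \<noteq> 0" and roots: "\<And>z. poly p z = 0 \<Longrightarrow> poly f z = 0"
  shows "p dvd f ^ degree p"
proof -
  obtain A where A: "size A = degree p" "p = smult (lead_coeff p) (\<Prod>x\<in>#A. [:-x, 1:])"
    using alg_closed_imp_factorization[OF assms(1)] by blast
  have "\<forall>x\<in>#A. poly p x = 0"
  proof
    fix x assume "x \<in># A"
    then have "[:-x, 1:] dvd (\<Prod>x\<in>#A. [:-x, 1:])"
      by (auto dest!: multi_member_split simp del: mult_pCons_left)
    then have "[:-x, 1:] dvd p"
      by (subst A(2)) (rule dvd_smult)
    then show "poly p x = 0"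
      by (simp add: poly_eq_0_iff_dvd)
  qed
  then have "\<forall>x\<in>#A. [:-x, 1:] dvd f"
    using roots by (simp add: poly_eq_0_iff_dvd)
  then have "(\<Prod>x\<in>#A. [:-x, 1:]) dvd f ^ size A"
    by (induction A) (auto intro: mult_dvd_mono simp del: mult_pCons_left)
  then show ?thesis
    using A assms(1) by (metis leading_coeff_0_iff smult_dvd)
qed

lemma exists_poly_nonzero:
  fixes p :: "'k::field_char_0 poly"
  assumes "p \<noteq> 0"
  obtains s where "poly p s \<noteq> 0"
proof -
  have "finite {s. poly p s = 0}"
    using assms by (rule poly_roots_finite)
  then show ?thesis
    using that ex_new_if_finite[OF infinite_UNIV_char_0] by blast
qed

text \<open>The variable \<open>s\<close> is a prime element, and it does not divide \<open>P\<close> because the slice of \<open>P\<close> at \<open>0\<close> is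
nonzero; so every power of \<open>s\<close> that divides \<open>P * Q\<close> divides \<open>Q\<close>.\<close>

lemma cancel_base_factor:
  fixes P Q X :: "'k::field_char_0 poly poly"
  assumes "smult ([:0, 1:] ^ k) X = P * Q" "slice 0 P \<noteq> 0"
  obtains Q' where "X = P * Q'"
proof -
  have "\<exists>Q'. X = P * Q'"
    using assms(1)
  proof (induction k arbitrary: Q)
    case 0
    then show ?case by auto
  next
    case (Suc k)
    have "slice 0 P * slice 0 Q = slice 0 (smult ([:0, 1:] ^ Suc k) X)"
      by (simp only: Suc.prems slice_simps)
    also have "\<dots> = 0"
      by (simp add: slice_simps)
    finally have "slice 0 Q = 0"
      using assms(2) by simp
    then have "\<forall>i. [:0, 1:] dvd coeff Q i"
      by (metis coeff_slice coeff_0 poly_eq_0_iff_dvd neg_equal_0_iff_equal)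
    then have "[:[:0, 1:]:] dvd Q"
      by (simp add: const_poly_dvd_iff)
    then obtain Q1 where "Q = smult [:0, 1:] Q1"
      by (auto elim!: dvdE)
    with Suc.prems have "smult [:0, 1:] (smult ([:0, 1:] ^ k) X) = smult [:0, 1:] (P * Q1)"
      by (simp only: power_Suc smult_smult mult_smult_right)
    then have "smult ([:0, 1:] ^ k) X = P * Q1"
      by (metis mult_smult_left pCons_eq_0_iff smult_cancel one_neq_zero)
    then show ?case by (rule Suc.IH)
  qed
  then show ?thesis using that by blast
qed

text \<open>Pseudo-division of a power of \<open>F\<close> by \<open>P\<close> leaves a remainder that vanishes on all but finitely many
slices, hence is zero.  So \<open>P\<close> divides \<open>a F\<^sup>d\<close> for some nonzero polynomial \<open>a\<close> in \<open>s\<close>.  The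
factors \<open>s\<close> of \<open>a\<close> can be cancelled, since the curve has no vertical component over \<open>0\<close>.\<close>

lemma vanishing_on_plane_curve:
  fixes P F :: "'k::{alg_closed_field,field_char_0} poly poly" and h :: "'k poly"
  assumes h: "h \<noteq> 0" and P0: "slice 0 P \<noteq> 0" and z0: "poly (slice 0 P) z0 = 0"
    and van: "\<And>s z. poly h s \<noteq> 0 \<Longrightarrow> poly (slice s P) z = 0 \<Longrightarrow> poly (slice s F) z = 0"
  shows "poly (slice 0 F) z0 = 0"
proof -
  define d where "d = degree P"
  have P: "P \<noteq> 0"
    using P0 by (auto simp: slice_def)
  define R where "R = pseudo_mod (F ^ d) P"
  obtain a Q where a: "a \<noteq> 0" and aQ: "smult a (F ^ d) = P * Q + R"
    using pseudo_mod(1)[OF P, of "F ^ d"] unfolding R_def by blast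
  have degR: "R = 0 \<or> degree R < d"
    using pseudo_mod(2)[OF P, of "F ^ d"] unfolding R_def d_def by blast
  \<comment> \<open>On a slice where the degree of \<open>P\<close> does not drop, all roots of \<open>P\<close> are roots of \<open>F\<close>, so the
     remainder is a multiple of \<open>P\<close> of smaller degree.\<close>
  have "R = 0"
  proof (rule ccontr)
    assume "R \<noteq> 0"
    then obtain s where s: "poly (h * lead_coeff P * lead_coeff R) s \<noteq> 0"
      using h P by (metis exists_poly_nonzero leading_coeff_0_iff mult_eq_0_iff)
    then have nz: "slice s P \<noteq> 0" "slice s R \<noteq> 0"
      by (metis coeff_0 coeff_slice mult_zero_left mult_zero_right poly_mult)+
    have "poly (lead_coeff P) s \<noteq> 0"
      using s by auto
    then have deg: "degree (slice s P) = d"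
      unfolding d_def by (intro antisym degree_le le_degree) (auto simp: coeff_eq_0)
    have "slice s P dvd slice s F ^ d"
      using poly_dvd_power_degree[OF nz(1), of "slice s F"] van[of s] s by (simp add: deg)
    moreover have "smult (poly a s) (slice s F ^ d) = slice s P * slice s Q + slice s R"
      using arg_cong[OF aQ, of "slice s"] by (simp add: slice_simps)
    ultimately have "slice s P dvd slice s R"
      by (metis dvd_add_right_iff dvd_smult dvd_triv_left)
    then have "d \<le> degree (slice s R)"
      using nz deg dvd_imp_degree_le by metis
    moreover have "degree (slice s R) \<le> degree R"
      by (intro degree_le) (auto simp: coeff_eq_0)
    ultimately show False
      using degR \<open>R \<noteq> 0\<close> by linarith
  qed
  obtain k b where ab: "a = [:0, 1:] ^ k * b" "poly b 0 \<noteq> 0"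
    using order_decomp[OF a, of 0] by (auto simp: poly_eq_0_iff_dvd)
  have "smult ([:0, 1:] ^ k) (smult b (F ^ d)) = P * Q"
    using aQ \<open>R = 0\<close> by (simp add: ab(1))
  then obtain Q' where "smult b (F ^ d) = P * Q'"
    using P0 by (rule cancel_base_factor)
  from arg_cong[OF this, of "\<lambda>X. poly (slice 0 X) z0"] have "poly b 0 * poly (slice 0 F) z0 ^ d = 0"
    by (simp add: slice_simps z0)
  then show ?thesis
    using ab(2) by simp
qed

text \<open>Polynomial functions of \<open>(s, z)\<close>, given by existence of a polynomial so that the closure rules below
replace the bookkeeping of coefficients.\<close>

definition plane_poly :: "('k::field \<Rightarrow> 'k \<Rightarrow> 'k) \<Rightarrow> bool" where
  "plane_poly f \<longleftrightarrow> (\<exists>P. \<forall>s z. f s z = poly (slice s P) z)"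

lemma plane_poly_intros:
  fixes f g :: "'k::field_char_0 \<Rightarrow> 'k \<Rightarrow> 'k"
  shows "plane_poly (\<lambda>s z. c)" "plane_poly (\<lambda>s z. s)" "plane_poly (\<lambda>s z. z)"
    "plane_poly f \<Longrightarrow> plane_poly g \<Longrightarrow> plane_poly (\<lambda>s z. f s z + g s z)"
    "plane_poly f \<Longrightarrow> plane_poly g \<Longrightarrow> plane_poly (\<lambda>s z. f s z - g s z)"
    "plane_poly f \<Longrightarrow> plane_poly (\<lambda>s z. - f s z)"
    "plane_poly f \<Longrightarrow> plane_poly g \<Longrightarrow> plane_poly (\<lambda>s z. f s z * g s z)"
    "plane_poly f \<Longrightarrow> plane_poly (\<lambda>s z. f s z ^ n)"
proof -
  show "plane_poly (\<lambda>s z. c)"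
    unfolding plane_poly_def by (rule exI[of _ "[:[:c:]:]"]) (simp add: slice_def map_poly_pCons)
  show "plane_poly (\<lambda>s z. s)"
    unfolding plane_poly_def by (rule exI[of _ "[:[:0, 1:]:]"]) (simp add: slice_def map_poly_pCons)
  show "plane_poly (\<lambda>s z. z)"
    unfolding plane_poly_def by (rule exI[of _ "[:0, 1:]"]) (simp add: slice_def map_poly_pCons)
  show add: "plane_poly (\<lambda>s z. f s z + g s z)" if "plane_poly f" "plane_poly g" for f g :: "'k \<Rightarrow> 'k \<Rightarrow> 'k"
    using that unfolding plane_poly_def by (metis poly_add slice_simps(1))
  show mult: "plane_poly (\<lambda>s z. f s z * g s z)" if "plane_poly f" "plane_poly g" for f g :: "'k \<Rightarrow> 'k \<Rightarrow> 'k"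
    using that unfolding plane_poly_def by (metis poly_mult slice_simps(2))
  show "plane_poly (\<lambda>s z. f s z ^ n)" if "plane_poly f" for f :: "'k \<Rightarrow> 'k \<Rightarrow> 'k"
    using that unfolding plane_poly_def by (metis poly_power slice_simps(3))
  have "plane_poly (\<lambda>s z. -1 :: 'k)"
    unfolding plane_poly_def by (rule exI[of _ "[:[:-1:]:]"]) (simp add: slice_def map_poly_pCons)
  then show neg: "plane_poly (\<lambda>s z. - f s z)" if "plane_poly f" for f :: "'k \<Rightarrow> 'k \<Rightarrow> 'k"
    using mult[of "\<lambda>s z. -1" f] that by simp
  show "plane_poly (\<lambda>s z. f s z - g s z)" if "plane_poly f" "plane_poly g" for f g :: "'k \<Rightarrow> 'k \<Rightarrow> 'k"
    using add[of f "\<lambda>s z. - g s z"] neg[of g] that by simp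
qed

lemma plane_poly_sum:
  fixes f :: "'i \<Rightarrow> 'k::field_char_0 \<Rightarrow> 'k \<Rightarrow> 'k"
  assumes "\<And>i. i \<in> A \<Longrightarrow> plane_poly (f i)"
  shows "plane_poly (\<lambda>s z. \<Sum>i\<in>A. f i s z)" "plane_poly (\<lambda>s z. \<Prod>i\<in>A. f i s z)"
  using assms by (induction A rule: infinite_finite_induct) (simp_all add: plane_poly_intros)

lemma plane_poly_mpol_eval:
  fixes F :: "'k::field_char_0 mpol"
  assumes "\<And>i. plane_poly (\<lambda>s z. x s z i)"
  shows "plane_poly (\<lambda>s z. mpol_eval F (x s z))"
  unfolding mpol_eval_def by (intro plane_poly_sum plane_poly_intros assms)

text \<open>The form of the previous result that is used: \<open>h\<close> is a polynomial in \<open>s\<close> alone, and \<open>z1\<close> and \<open>s1\<close>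
witness that \<open>P\<close> is nonzero over \<open>0\<close> and that \<open>h\<close> is nonzero.\<close>

lemma density_along_plane_curve:
  fixes P f h :: "'k::{alg_closed_field,field_char_0} \<Rightarrow> 'k \<Rightarrow> 'k"
  assumes poly: "plane_poly P" "plane_poly f" "plane_poly h"
    and h: "\<And>s z. h s z = h s 0" "h s1 0 \<noteq> 0"
    and P: "P 0 z1 \<noteq> 0" "P 0 z0 = 0"
    and van: "\<And>s z. P s z = 0 \<Longrightarrow> h s z * f s z = 0"
  shows "f 0 z0 = 0"
proof -
  obtain P' f' h' where eqs: "\<And>s z. P s z = poly (slice s P') z" "\<And>s z. f s z = poly (slice s f') z"
      "\<And>s z. h s z = poly (slice s h') z"
    using poly unfolding plane_poly_def by metis
  have h0: "h s 0 = poly (coeff h' 0) s" for s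
    by (simp add: eqs poly_0_coeff_0)
  have "poly (slice 0 f') z0 = 0"
  proof (rule vanishing_on_plane_curve[of "coeff h' 0" P' z0 f'])
    show "coeff h' 0 \<noteq> 0"
      using h(2) h0[of s1] by auto
    show "slice 0 P' \<noteq> 0"
      using P(1) eqs(1) by auto
    show "poly (slice 0 P') z0 = 0"
      using P(2) eqs(1) by simp
    fix s z assume "poly (coeff h' 0) s \<noteq> 0" "poly (slice s P') z = 0"
    then show "poly (slice s f') z = 0"
      using van[of s z] h(1)[of s z] h0[of s] eqs by auto
  qed
  then show ?thesis
    by (simp add: eqs)
qed

section \<open>Rational maps given by homogeneous polynomials\<close>

definition hom_poly :: "nat set \<Rightarrow> (nat \<Rightarrow> nat) \<Rightarrow> nat \<Rightarrow> ((nat \<Rightarrow> 'k::field) \<Rightarrow> 'k) \<Rightarrow> bool" where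
  "hom_poly I w d f \<longleftrightarrow> (\<exists>F\<in>whomog I w d. \<forall>x. mpol_eval F x = f x)"

lemma whomog_add: "F \<in> whomog I w d \<Longrightarrow> G \<in> whomog I w d \<Longrightarrow> F + G \<in> whomog I w d"
  using keys_add[of F G] by (fastforce simp: whomog_def)

lemma hom_poly_const: "hom_poly I w 0 (\<lambda>x. c)"
  unfolding hom_poly_def
  by (rule bexI[of _ "Poly_Mapping.single 0 c"]) (auto simp: mpol_eval_single whomog_def)

lemma hom_poly_zero: "hom_poly I w d (\<lambda>x. 0)"
  unfolding hom_poly_def by (rule bexI[of _ 0]) (auto simp: whomog_def)

lemma hom_poly_var: "i \<in> I \<Longrightarrow> w i = d \<Longrightarrow> hom_poly I w d (\<lambda>x. x i)"
  unfolding hom_poly_def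
  by (rule bexI[of _ "Poly_Mapping.single (Poly_Mapping.single i 1) 1"])
    (auto simp: mpol_eval_single whomog_def)

lemma hom_poly_add: "hom_poly I w d f \<Longrightarrow> hom_poly I w d g \<Longrightarrow> hom_poly I w d (\<lambda>x. f x + g x)"
  unfolding hom_poly_def by (metis mpol_eval_add whomog_add)

lemma hom_poly_mult:
  "hom_poly I w d f \<Longrightarrow> hom_poly I w e g \<Longrightarrow> k = d + e \<Longrightarrow> hom_poly I w k (\<lambda>x. f x * g x)"
  unfolding hom_poly_def by (metis mpol_eval_mult whomog_mult)

lemma hom_poly_scale: "hom_poly I w d f \<Longrightarrow> hom_poly I w d (\<lambda>x. c * f x)"
  by (rule hom_poly_mult[OF hom_poly_const]) simp_all

lemma hom_poly_uminus: "hom_poly I w d f \<Longrightarrow> hom_poly I w d (\<lambda>x. - f x)"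
  using hom_poly_scale[of I w d f "-1"] by simp

lemma hom_poly_diff: "hom_poly I w d f \<Longrightarrow> hom_poly I w d g \<Longrightarrow> hom_poly I w d (\<lambda>x. f x - g x)"
  using hom_poly_add[OF _ hom_poly_uminus, of I w d f g] by simp

lemma hom_poly_power: "hom_poly I w d f \<Longrightarrow> k = d * n \<Longrightarrow> hom_poly I w k (\<lambda>x. f x ^ n)"
  by (induction n arbitrary: k) (auto simp: hom_poly_const intro: hom_poly_mult)

lemma hom_poly_sum:
  "(\<And>i. i \<in> A \<Longrightarrow> hom_poly I w d (f i)) \<Longrightarrow> hom_poly I w d (\<lambda>x. \<Sum>i\<in>A. f i x)"
  by (induction A rule: infinite_finite_induct) (simp_all add: hom_poly_add hom_poly_zero)

lemma hom_poly_prod: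
  "finite A \<Longrightarrow> (\<And>i. i \<in> A \<Longrightarrow> hom_poly I w (d i) (f i)) \<Longrightarrow> hom_poly I w (\<Sum>i\<in>A. d i) (\<lambda>x. \<Prod>i\<in>A. f i x)"
  by (induction A rule: finite_induct) (auto simp: hom_poly_const intro!: hom_poly_mult[OF _ _ refl])

text \<open>Substituting forms of degrees proportional to the weights into a weighted form gives a form; this is why
a tuple of such forms pulls the Zariski topology and regular functions back.\<close>

lemma hom_poly_compose:
  assumes F: "F \<in> whomog J v e" and \<Psi>: "\<And>j. j \<in> J \<Longrightarrow> hom_poly I w (c * v j) (\<lambda>y. \<Psi> y j)"
  shows "hom_poly I w (c * e) (\<lambda>y. mpol_eval F (\<Psi> y))"
  unfolding mpol_eval_def
proof (intro hom_poly_sum hom_poly_scale)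
  fix m assume m: "m \<in> Poly_Mapping.keys F"
  have "hom_poly I w (\<Sum>i\<in>Poly_Mapping.keys m. c * v i * Poly_Mapping.lookup m i)
          (\<lambda>y. \<Prod>i\<in>Poly_Mapping.keys m. \<Psi> y i ^ Poly_Mapping.lookup m i)"
    using F m by (intro hom_poly_prod hom_poly_power[OF \<Psi>]) (auto simp: whomog_def)
  also have "(\<Sum>i\<in>Poly_Mapping.keys m. c * v i * Poly_Mapping.lookup m i) = c * e"
    using F m by (auto simp: whomog_def sum_distrib_left mult.assoc)
  finally show "hom_poly I w (c * e) (\<lambda>y. \<Prod>i\<in>Poly_Mapping.keys m. \<Psi> y i ^ Poly_Mapping.lookup m i)" .
qed

lemma hom_poly_wscale:
  assumes "hom_poly I w d f"
  shows "f (wscale w k x) = k ^ d * f x"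
  using assms mpol_eval_wscale unfolding hom_poly_def by metis

abbreviation wpoint :: "nat set \<Rightarrow> (nat \<Rightarrow> nat) \<Rightarrow> (nat \<Rightarrow> 'k::field) \<Rightarrow> (nat \<Rightarrow> 'k) set" where
  "wpoint I w x \<equiv> wproj_rel I w `` {x}"

lemma wpoint_in_wproj: "x \<in> nonzero_vecs I \<Longrightarrow> wpoint I w x \<in> wproj I w"
  unfolding wproj_def by (rule quotientI)

lemma wproj_eq_wpoint:
  assumes "p \<in> wproj I w" "x \<in> p"
  shows "p = wpoint I w x" "x \<in> nonzero_vecs I"
proof -
  obtain y where "y \<in> nonzero_vecs I" "p = wpoint I w y"
    using assms(1) unfolding wproj_def by (rule quotientE)
  moreover from this have yx: "(y, x) \<in> wproj_rel I w"
    using assms(2) by blast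
  ultimately show "p = wpoint I w x"
    using equiv_class_eq[OF equiv_wproj_rel] by blast
  show "x \<in> nonzero_vecs I"
    using yx by (auto simp: wproj_rel_def)
qed

lemma wproj_nonempty: "p \<in> wproj I w \<Longrightarrow> \<exists>x. x \<in> p"
  unfolding wproj_def using in_quotient_imp_non_empty[OF equiv_wproj_rel] by blast

lemma in_wpointD: "y \<in> wpoint I w x \<Longrightarrow> \<exists>k. k \<noteq> 0 \<and> y = wscale w k x"
  by (auto simp: wproj_rel_def)

lemma self_in_wpoint: "x \<in> nonzero_vecs I \<Longrightarrow> x \<in> wpoint I w x"
  using equiv_class_self[OF equiv_wproj_rel] by blast

lemma wscale_nonzero_vecs: "x \<in> nonzero_vecs I \<Longrightarrow> k \<noteq> 0 \<Longrightarrow> wscale w k x \<in> nonzero_vecs I"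
  by (auto simp: nonzero_vecs_def wscale_def)

lemma wscale_in_wpoint: "x \<in> nonzero_vecs I \<Longrightarrow> k \<noteq> 0 \<Longrightarrow> wscale w k x \<in> wpoint I w x"
  using wscale_nonzero_vecs by (auto simp: wproj_rel_def)

lemma wpoint_wscale: "x \<in> nonzero_vecs I \<Longrightarrow> k \<noteq> 0 \<Longrightarrow> wpoint I w (wscale w k x) = wpoint I w x"
  using wproj_eq_wpoint(1)[OF wpoint_in_wproj wscale_in_wpoint] by metis

lemma mpol_zero_on_wpoint_iff:
  assumes "F \<in> whomog I w d" "x \<in> nonzero_vecs I" "y \<in> wpoint I w x"
  shows "mpol_eval F y = 0 \<longleftrightarrow> mpol_eval F x = 0"
  using wproj_eval_zero_iff[OF wpoint_in_wproj assms(3) self_in_wpoint assms(1)] assms(2) by blast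

lemma wpoint_in_zero_locus_iff:
  assumes "S \<subseteq> (\<Union>d. whomog I w d)" "x \<in> nonzero_vecs I"
  shows "wpoint I w x \<in> zero_locus I w S \<longleftrightarrow> (\<forall>F\<in>S. mpol_eval F x = 0)"
proof
  assume "wpoint I w x \<in> zero_locus I w S"
  then show "\<forall>F\<in>S. mpol_eval F x = 0"
    using self_in_wpoint[OF assms(2)] by (auto simp: zero_locus_def)
next
  assume *: "\<forall>F\<in>S. mpol_eval F x = 0"
  have "mpol_eval F y = 0" if "F \<in> S" "y \<in> wpoint I w x" for F y
    using that assms * mpol_zero_on_wpoint_iff by blast
  then show "wpoint I w x \<in> zero_locus I w S"
    using wpoint_in_wproj[OF assms(2)] by (auto simp: zero_locus_def)
qed

text \<open>A tuple of forms on projective \<open>n\<close>-space whose degrees are \<open>c\<close> times the weights of the target.  It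
defines a rational map, which is a morphism on the open set where not all the forms vanish.\<close>

locale hom_map =
  fixes n c :: nat and J :: "nat set" and v :: "nat \<Rightarrow> nat"
    and \<Psi> :: "(nat \<Rightarrow> 'k::field) \<Rightarrow> nat \<Rightarrow> 'k"
  assumes coord: "\<And>j. j \<in> J \<Longrightarrow> hom_poly {..n} (\<lambda>_. 1) (c * v j) (\<lambda>y. \<Psi> y j)"
    and supp: "\<And>y j. j \<notin> J \<Longrightarrow> \<Psi> y j = 0"
begin

abbreviation "one \<equiv> (\<lambda>_::nat. 1::nat)"

definition coord_polys :: "'k mpol set" where
  "coord_polys = {F. \<exists>j\<in>J. F \<in> whomog {..n} one (c * v j) \<and> (\<forall>y. mpol_eval F y = \<Psi> y j)}"

definition defined_set :: "(nat \<Rightarrow> 'k) set set" where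
  "defined_set = wproj {..n} one - zero_locus {..n} one coord_polys"

definition point_map :: "(nat \<Rightarrow> 'k) set \<Rightarrow> (nat \<Rightarrow> 'k) set" where
  "point_map p = wpoint J v (\<Psi> (SOME x. x \<in> p))"

lemma \<Psi>_wscale: "\<Psi> (wscale one k y) = wscale v (k ^ c) (\<Psi> y)"
proof
  fix j
  show "\<Psi> (wscale one k y) j = wscale v (k ^ c) (\<Psi> y) j"
    using hom_poly_wscale[OF coord] supp by (cases "j \<in> J") (simp_all add: wscale_def power_mult)
qed

lemma openin_defined_set: "openin (zariski {..n} one) defined_set"
  unfolding openin_zariski defined_set_def
  by (rule exI[of _ coord_polys]) (auto simp: coord_polys_def)

lemma coord_polys_vanish_iff: "(\<forall>F\<in>coord_polys. mpol_eval F y = 0) \<longleftrightarrow> (\<forall>j\<in>J. \<Psi> y j = 0)"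
  using coord unfolding coord_polys_def hom_poly_def by fastforce

lemma wpoint_in_defined_set_iff:
  assumes "y \<in> nonzero_vecs {..n}"
  shows "wpoint {..n} one y \<in> defined_set \<longleftrightarrow> \<Psi> y \<in> nonzero_vecs J"
proof -
  have "wpoint {..n} one y \<in> defined_set \<longleftrightarrow> \<not> (\<forall>F\<in>coord_polys. mpol_eval F y = 0)"
    unfolding defined_set_def using assms
    by (subst wpoint_in_zero_locus_iff[symmetric]) (auto simp: coord_polys_def wpoint_in_wproj)
  then show ?thesis
    using supp by (auto simp: coord_polys_vanish_iff nonzero_vecs_def)
qed

lemma
  assumes "p \<in> defined_set" "y \<in> p"
  shows defined_set_member: "y \<in> nonzero_vecs {..n}" "p = wpoint {..n} one y" "\<Psi> y \<in> nonzero_vecs J"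
    and point_map_eq: "point_map p = wpoint J v (\<Psi> y)"
proof -
  have p: "p \<in> wproj {..n} one"
    using assms(1) by (simp add: defined_set_def)
  show y: "y \<in> nonzero_vecs {..n}" and py: "p = wpoint {..n} one y"
    using wproj_eq_wpoint[OF p assms(2)] by auto
  show \<Psi>y: "\<Psi> y \<in> nonzero_vecs J"
    using wpoint_in_defined_set_iff[OF y] assms(1) py by simp
  have "(SOME x. x \<in> p) \<in> wpoint {..n} one y"
    using assms(2) py by (metis someI)
  then obtain k where "k \<noteq> 0" "(SOME x. x \<in> p) = wscale one k y"
    using in_wpointD by metis
  then show "point_map p = wpoint J v (\<Psi> y)"
    by (metis point_map_def \<Psi>_wscale wpoint_wscale[OF \<Psi>y] power_not_zero)
qed

lemma point_map_wpoint:
  assumes "y \<in> nonzero_vecs {..n}" "\<Psi> y \<in> nonzero_vecs J"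
  shows "wpoint {..n} one y \<in> defined_set" "point_map (wpoint {..n} one y) = wpoint J v (\<Psi> y)"
  using assms wpoint_in_defined_set_iff point_map_eq self_in_wpoint by blast+

definition pullback :: "'k mpol set \<Rightarrow> 'k mpol set" where
  "pullback S = {F'. \<exists>F\<in>S. \<exists>d. F \<in> whomog J v d \<and> F' \<in> whomog {..n} one (c * d) \<and>
     (\<forall>y. mpol_eval F' y = mpol_eval F (\<Psi> y))}"

lemma pullback_exists:
  assumes "F \<in> whomog J v d"
  obtains F' where "F' \<in> whomog {..n} one (c * d)" "\<And>y. mpol_eval F' y = mpol_eval F (\<Psi> y)"
  using hom_poly_compose[OF assms coord] unfolding hom_poly_def by blast

lemma continuous_point_map:
  assumes X: "point_map ` defined_set \<subseteq> X" "X \<subseteq> wproj J v"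
  shows "continuous_map (subtopology (zariski {..n} one) defined_set) (subtopology (zariski J v) X) point_map"
  unfolding continuous_map
proof (intro conjI allI impI)
  show "point_map ` topspace (subtopology (zariski {..n} one) defined_set) \<subseteq> topspace (subtopology (zariski J v) X)"
    using X by auto
next
  fix V assume "openin (subtopology (zariski J v) X) V"
  then obtain S where S: "S \<subseteq> (\<Union>d. whomog J v d)" "V = (wproj J v - zero_locus J v S) \<inter> X"
    by (auto simp: openin_subtopology openin_zariski)
  have pull: "pullback S \<subseteq> (\<Union>d. whomog {..n} one d)"
    by (auto simp: pullback_def)
  have "point_map p \<in> V \<longleftrightarrow> p \<notin> zero_locus {..n} one (pullback S)" if p: "p \<in> defined_set" for p
  proof -
    obtain y where y: "y \<in> p"
      using p wproj_nonempty unfolding defined_set_def by blast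
    note py = defined_set_member[OF p y] point_map_eq[OF p y]
    have "point_map p \<in> V \<longleftrightarrow> \<not> (\<forall>F\<in>S. mpol_eval F (\<Psi> y) = 0)"
      using X p S(2) wpoint_in_zero_locus_iff[OF S(1) py(3)] py(4) wpoint_in_wproj[OF py(3)] by auto
    also have "(\<forall>F\<in>S. mpol_eval F (\<Psi> y) = 0) \<longleftrightarrow> (\<forall>F\<in>pullback S. mpol_eval F y = 0)"
    proof
      assume *: "\<forall>F\<in>pullback S. mpol_eval F y = 0"
      show "\<forall>F\<in>S. mpol_eval F (\<Psi> y) = 0"
      proof
        fix F assume F: "F \<in> S"
        then obtain d where d: "F \<in> whomog J v d"
          using S(1) by blast
        then obtain F' where F': "F' \<in> whomog {..n} one (c * d)" "\<And>y. mpol_eval F' y = mpol_eval F (\<Psi> y)"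
          using pullback_exists by blast
        then have "F' \<in> pullback S"
          using F d unfolding pullback_def by blast
        with * F'(2) show "mpol_eval F (\<Psi> y) = 0" by metis
      qed
    qed (auto simp: pullback_def)
    also have "\<dots> \<longleftrightarrow> p \<in> zero_locus {..n} one (pullback S)"
      using wpoint_in_zero_locus_iff[OF pull py(1)] py(2) by metis
    finally show ?thesis .
  qed
  then have "{p \<in> topspace (subtopology (zariski {..n} one) defined_set). point_map p \<in> V} =
      (wproj {..n} one - zero_locus {..n} one (pullback S)) \<inter> defined_set"
    by (auto simp: defined_set_def)
  then show "openin (subtopology (zariski {..n} one) defined_set)
      {p \<in> topspace (subtopology (zariski {..n} one) defined_set). point_map p \<in> V}"
    using pull by (auto simp: openin_subtopology openin_zariski)
qed

lemma morphism_point_map: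
  assumes X: "point_map ` defined_set \<subseteq> X" "X \<subseteq> wproj J v"
  shows "morphism {..n} one defined_set J v X point_map"
  unfolding morphism_def
proof (intro conjI allI impI)
  show cont: "continuous_map (subtopology (zariski {..n} one) defined_set) (subtopology (zariski J v) X) point_map"
    by (rule continuous_point_map[OF X])
  fix V f assume V: "openin (subtopology (zariski J v) X) V" and f: "regular_on J v V f"
  have VX: "V \<subseteq> X"
    using V by (auto simp: openin_subtopology)
  let ?W = "{p \<in> defined_set. point_map p \<in> V}"
  show "regular_on {..n} one ?W (f \<circ> point_map)"
    unfolding regular_on_def
  proof
    fix p assume p: "p \<in> ?W"
    then obtain V' d F G where FG: "F \<in> whomog J v d" "G \<in> whomog J v d"
      and V': "openin (subtopology (zariski J v) V) V'" "point_map p \<in> V'"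
      and f_eq: "\<forall>q\<in>V'. \<forall>x\<in>q. mpol_eval G x \<noteq> 0 \<and> f q = mpol_eval F x / mpol_eval G x"
      using f unfolding regular_on_def by blast
    obtain F' G' where F': "F' \<in> whomog {..n} one (c * d)" "\<And>y. mpol_eval F' y = mpol_eval F (\<Psi> y)"
      and G': "G' \<in> whomog {..n} one (c * d)" "\<And>y. mpol_eval G' y = mpol_eval G (\<Psi> y)"
      using pullback_exists[OF FG(1)] pullback_exists[OF FG(2)] by metis
    have V'V: "V' \<subseteq> V"
      using V'(1) by (auto simp: openin_subtopology)
    let ?W' = "{q \<in> defined_set. point_map q \<in> V'}"
    obtain T where T: "openin (zariski J v) T" "V' = T \<inter> V"
      using V'(1) by (auto simp: openin_subtopology)
    have "openin (subtopology (zariski J v) X) (T \<inter> X)"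
      using T(1) by (auto simp: openin_subtopology)
    then have "openin (subtopology (zariski {..n} one) defined_set)
        {q \<in> topspace (subtopology (zariski {..n} one) defined_set). point_map q \<in> T \<inter> X}"
      using cont unfolding continuous_map by blast
    then obtain T' where T': "openin (zariski {..n} one) T'"
        "{q \<in> topspace (subtopology (zariski {..n} one) defined_set). point_map q \<in> T \<inter> X} = T' \<inter> defined_set"
      unfolding openin_subtopology by blast
    then have "?W' = T' \<inter> ?W"
      using T(2) VX by (auto simp: defined_set_def)
    then have "openin (subtopology (zariski {..n} one) ?W) ?W'"
      using T'(1) by (auto simp: openin_subtopology)
    moreover have "\<forall>q\<in>?W'. \<forall>y\<in>q. mpol_eval G' y \<noteq> 0 \<and>
        (f \<circ> point_map) q = mpol_eval F' y / mpol_eval G' y"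
    proof (intro ballI)
      fix q y assume q: "q \<in> ?W'" and y: "y \<in> q"
      then have "\<Psi> y \<in> point_map q"
        using point_map_eq[of q y] defined_set_member[of q y] self_in_wpoint by auto
      then show "mpol_eval G' y \<noteq> 0 \<and> (f \<circ> point_map) q = mpol_eval F' y / mpol_eval G' y"
        using f_eq q unfolding F'(2) G'(2) comp_apply by blast
    qed
    ultimately show "\<exists>V d. \<exists>F\<in>whomog {..n} one d. \<exists>G\<in>whomog {..n} one d.
        openin (subtopology (zariski {..n} one) ?W) V \<and> p \<in> V \<and>
        (\<forall>q\<in>V. \<forall>x\<in>q. mpol_eval G x \<noteq> 0 \<and> (f \<circ> point_map) q = mpol_eval F x / mpol_eval G x)"
      using p V'(2) F'(1) G'(1)
      by (intro exI[of _ ?W'] exI[of _ "c * d"] bexI[of _ F'] bexI[of _ G'] conjI) auto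
  qed
qed

text \<open>Density of the image is stated through polynomials: a form that vanishes on the image vanishes on the
whole locus.  It also yields that the rational map is defined somewhere, by applying it to the constant
form \<open>1\<close>.\<close>

theorem unirational_of_dense_image:
  fixes C :: "(nat \<Rightarrow> 'k) \<Rightarrow> bool"
  assumes inX: "\<And>y. y \<in> nonzero_vecs {..n} \<Longrightarrow> C (\<Psi> y)"
    and C_wscale: "\<And>x k. C x \<Longrightarrow> k \<noteq> 0 \<Longrightarrow> C (wscale v k x)"
    and dense: "\<And>d F x. F \<in> whomog J v d \<Longrightarrow>
      (\<And>y. y \<in> nonzero_vecs {..n} \<Longrightarrow> \<Psi> y \<in> nonzero_vecs J \<Longrightarrow> mpol_eval F (\<Psi> y) = 0) \<Longrightarrow>
      x \<in> nonzero_vecs J \<Longrightarrow> C x \<Longrightarrow> mpol_eval F x = 0"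
    and nonempty: "x0 \<in> nonzero_vecs J" "C x0"
  shows "unirational J v {p \<in> wproj J v. \<forall>x\<in>p. C x}" (is "unirational J v ?X")
  unfolding unirational_def
proof (intro exI conjI)
  show "openin (zariski {..n} one) defined_set"
    by (rule openin_defined_set)
  show "defined_set \<noteq> {}"
  proof
    assume "defined_set = {}"
    then have no: "\<Psi> y \<notin> nonzero_vecs J" if "y \<in> nonzero_vecs {..n}" for y
      using point_map_wpoint(1) that by blast
    have "mpol_eval (1 :: 'k mpol) x0 = 0"
      by (rule dense[of 1 0]) (use no nonempty in \<open>auto simp: whomog_def\<close>)
    then show False
      using mpol_eval_single[of 0 "1 :: 'k" x0] by simp
  qed
  have "point_map p \<in> ?X" if p: "p \<in> defined_set" for p
  proof -
    obtain y where y: "y \<in> p"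
      using p wproj_nonempty unfolding defined_set_def by blast
    note py = defined_set_member[OF p y] point_map_eq[OF p y]
    have "C x" if "x \<in> wpoint J v (\<Psi> y)" for x
      using in_wpointD[OF that] C_wscale[OF inX[OF py(1)]] by metis
    then show ?thesis
      using py wpoint_in_wproj by auto
  qed
  then have sub: "point_map ` defined_set \<subseteq> ?X" by blast
  then show "morphism {..n} one defined_set J v ?X point_map"
    by (rule morphism_point_map) auto
  show "subtopology (zariski J v) ?X closure_of point_map ` defined_set = ?X"
  proof (rule antisym)
    show "subtopology (zariski J v) ?X closure_of point_map ` defined_set \<subseteq> ?X"
      using closure_of_subset_topspace[of "subtopology (zariski J v) ?X"] by auto
    show "?X \<subseteq> subtopology (zariski J v) ?X closure_of point_map ` defined_set"
    proof
      fix p assume p: "p \<in> ?X"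
      then obtain x where x: "x \<in> p"
        using wproj_nonempty by blast
      have px: "p = wpoint J v x" "x \<in> nonzero_vecs J" "C x"
        using wproj_eq_wpoint[of p J v x] p x by auto
      have "\<exists>q\<in>point_map ` defined_set. q \<in> T" if T: "p \<in> T" "openin (subtopology (zariski J v) ?X) T" for T
      proof (rule ccontr)
        assume none: "\<not> ?thesis"
        obtain S where S: "S \<subseteq> (\<Union>d. whomog J v d)" "T = (wproj J v - zero_locus J v S) \<inter> ?X"
          using T(2) unfolding openin_subtopology openin_zariski by blast
        have "mpol_eval F x = 0" if F: "F \<in> S" for F
        proof -
          obtain d where d: "F \<in> whomog J v d"
            using S(1) F by blast
          have "mpol_eval F (\<Psi> y) = 0" if y: "y \<in> nonzero_vecs {..n}" "\<Psi> y \<in> nonzero_vecs J" for y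
          proof -
            have "wpoint J v (\<Psi> y) \<in> point_map ` defined_set"
              using point_map_wpoint[OF y] by (metis imageI)
            then have "wpoint J v (\<Psi> y) \<in> zero_locus J v S"
              using none sub S(2) by blast
            then show ?thesis
              using wpoint_in_zero_locus_iff[OF S(1) y(2)] F by blast
          qed
          then show ?thesis
            using dense d px by blast
        qed
        then have "p \<in> zero_locus J v S"
          using wpoint_in_zero_locus_iff[OF S(1) px(2)] px(1) by blast
        then show False
          using T(1) S(2) by blast
      qed
      then show "p \<in> subtopology (zariski J v) ?X closure_of point_map ` defined_set"
        using p by (auto simp: in_closure_of)
    qed
  qed
qed

end

section \<open>The Coble fourfold as a product of two planes\<close>

type_synonym 'k triple = "'k \<times> 'k \<times> 'k"

definition smul :: "'k::field \<Rightarrow> 'k triple \<Rightarrow> 'k triple" where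
  "smul c v = (case v of (x, y, z) \<Rightarrow> (c * x, c * y, c * z))"

lemma smul_simp [simp]: "smul c (x, y, z) = (c * x, c * y, c * z)"
  by (simp add: smul_def)

text \<open>The rational map from the cubic fourfold \<open>a\<^sub>1 a\<^sub>2 a\<^sub>3 = b\<^sub>1 b\<^sub>2 b\<^sub>3\<close> to the Coble fourfold.  The coordinates
of positive index are linear forms with sum zero that are invariant under a simultaneous shift of all
\<open>a\<^sub>i\<close>, \<open>b\<^sub>i\<close>.  They give the projection to \<open>P\<^sup>4\<close> from \<open>(1 : 1 : 1 : 1 : 1 : 1)\<close>, a smooth point of
the cubic, so this projection has degree two.\<close>

fun cubic_coords :: "'k::field triple \<Rightarrow> 'k triple \<Rightarrow> nat \<Rightarrow> 'k" where
  "cubic_coords (a1, a2, a3) (b1, b2, b3) = (\<lambda>i.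
     if i = 0 then 36 * ((a1 * a2 + a2 * a3 + a1 * a3) - (b1 * b2 + b2 * b3 + b1 * b3))
     else if i = 1 then 6 * a1 - 4 * (a1 + a2 + a3) + 2 * (b1 + b2 + b3)
     else if i = 2 then 6 * a2 - 4 * (a1 + a2 + a3) + 2 * (b1 + b2 + b3)
     else if i = 3 then 6 * a3 - 4 * (a1 + a2 + a3) + 2 * (b1 + b2 + b3)
     else if i = 4 then 6 * b1 + 2 * (a1 + a2 + a3) - 4 * (b1 + b2 + b3)
     else if i = 5 then 6 * b2 + 2 * (a1 + a2 + a3) - 4 * (b1 + b2 + b3)
     else if i = 6 then 6 * b3 + 2 * (a1 + a2 + a3) - 4 * (b1 + b2 + b3)
     else 0)"

text \<open>The \<open>a\<^sub>i\<close> and \<open>b\<^sub>i\<close> are the six off-diagonal entries of the matrix \<open>u\<^sub>i v\<^sub>j\<close>, arranged so that both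
products equal \<open>u\<^sub>1 u\<^sub>2 u\<^sub>3 v\<^sub>1 v\<^sub>2 v\<^sub>3\<close>.\<close>

fun coble :: "'k::field triple \<Rightarrow> 'k triple \<Rightarrow> nat \<Rightarrow> 'k" where
  "coble (u1, u2, u3) (v1, v2, v3) =
     cubic_coords (u1 * v2, u2 * v3, u3 * v1) (u2 * v1, u3 * v2, u1 * v3)"

lemma sum_1_6: "(\<Sum>i=1..6. f i) = f 1 + f 2 + f 3 + f 4 + f 5 + (f (6::nat) :: 'k::field)"
  by (simp add: eval_nat_numeral)

text \<open>The affine cone over the section of the Coble fourfold by \<open>l x\<^sub>0 = m \<Sum> x\<^sub>i\<^sup>2\<close>.\<close>

definition coble_cone :: "'k::field \<Rightarrow> 'k \<Rightarrow> (nat \<Rightarrow> 'k) \<Rightarrow> bool" where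
  "coble_cone l m x \<longleftrightarrow> (\<Sum>i=1..6. x i) = 0 \<and>
     x 0 ^ 2 = (\<Sum>i=1..6. x i ^ 4) - 1 / 4 * (\<Sum>i=1..6. x i ^ 2) ^ 2 \<and>
     l * x 0 = m * (\<Sum>i=1..6. x i ^ 2)"

text \<open>The equation \<open>l x\<^sub>0 = m \<Sum> x\<^sub>i\<^sup>2\<close> pulled back along \<open>coble\<close> and divided by \<open>12\<close>: the sums \<open>a\<close>, \<open>b\<close> are
the first and \<open>c\<close>, \<open>d\<close> the second elementary symmetric functions of the two triples.\<close>

fun biquad :: "'k::field \<Rightarrow> 'k \<Rightarrow> 'k triple \<Rightarrow> 'k triple \<Rightarrow> 'k" where
  "biquad l m (u1, u2, u3) (v1, v2, v3) =
    (let a = u1 * v2 + u2 * v3 + u3 * v1; b = u2 * v1 + u3 * v2 + u1 * v3;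
         c = u1 * u2 * v2 * v3 + u2 * u3 * v1 * v3 + u1 * u3 * v1 * v2;
         d = u2 * u3 * v1 * v2 + u1 * u3 * v2 * v3 + u1 * u2 * v1 * v3
     in 3 * l * (c - d) - m * (4 * (a ^ 2 - a * b + b ^ 2) - 6 * (c + d)))"

definition polar :: "'k::field \<Rightarrow> 'k \<Rightarrow> 'k triple \<Rightarrow> 'k triple \<Rightarrow> 'k triple \<Rightarrow> 'k" where
  "polar l m u v w = biquad l m u (v + w) - biquad l m u v - biquad l m u w"

text \<open>Exchanging \<open>u\<close> and \<open>v\<close> exchanges the two triples and so changes the sign of \<open>x\<^sub>0\<close>.  It makes statements
about the conic in \<open>v\<close> available for the conic in \<open>u\<close>.\<close>

lemma biquad_swap: "biquad l m u v = biquad (- l) m v u"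
  by (cases u; cases v) (simp add: Let_def algebra_simps power2_eq_square)

lemma biquad_combine:
  "biquad l m u (smul x v + smul y w) =
     x ^ 2 * biquad l m u v + x * y * polar l m u v w + y ^ 2 * biquad l m u w"
proof -
  obtain u1 u2 u3 v1 v2 v3 w1 w2 w3 where uvw: "u = (u1, u2, u3)" "v = (v1, v2, v3)" "w = (w1, w2, w3)"
    by (metis prod_cases3)
  show ?thesis
    unfolding uvw polar_def Let_def biquad.simps smul_simp add_Pair by algebra
qed

lemma biquad_smul: "biquad l m (smul c u) v = c ^ 2 * biquad l m u v"
proof -
  obtain u1 u2 u3 v1 v2 v3 where uv: "u = (u1, u2, u3)" "v = (v1, v2, v3)"
    by (metis prod_cases3)
  show ?thesis
    unfolding uv Let_def biquad.simps smul_simp by algebra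
qed

lemma polar_smul: "polar l m (smul c u) v w = c ^ 2 * polar l m u v w"
  by (simp add: polar_def biquad_smul right_diff_distrib)

text \<open>The third identity is the reason for the whole construction.  With \<open>\<sigma>\<close> the difference of the sums of the
\<open>a\<^sub>i\<close> and of the \<open>b\<^sub>i\<close>, the quadratic polynomial \<open>\<Prod>(a\<^sub>i + \<beta>) - \<Prod>(b\<^sub>i + \<beta>)\<close> in \<open>\<beta>\<close> has leading coefficient
\<open>\<sigma>\<close>, linear coefficient \<open>x\<^sub>0 / 36\<close> and constant term \<open>a\<^sub>1 a\<^sub>2 a\<^sub>3 - b\<^sub>1 b\<^sub>2 b\<^sub>3\<close>.  Its discriminant is invariant
under shifts, and up to a constant it is the Igusa quartic.\<close>

lemma quartic_identity:
  fixes a1 a2 a3 b1 b2 b3 :: "'k::field_char_0"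
  defines "x \<equiv> cubic_coords (a1, a2, a3) (b1, b2, b3)"
  shows "(\<Sum>i=1..6. x i) = 0"
    and "(\<Sum>i=1..6. x i ^ 2) = 12 * (4 * ((a1 + a2 + a3)^2 - (a1 + a2 + a3) * (b1 + b2 + b3) + (b1 + b2 + b3)^2)
       - 6 * ((a1 * a2 + a2 * a3 + a1 * a3) + (b1 * b2 + b2 * b3 + b1 * b3)))"
    and "4 * x 0 ^ 2 = 4 * (\<Sum>i=1..6. x i ^ 4) - (\<Sum>i=1..6. x i ^ 2) ^ 2
       + 20736 * (a1 + a2 + a3 - b1 - b2 - b3) * (a1 * a2 * a3 - b1 * b2 * b3)"
  unfolding sum_1_6 x_def by (simp_all, algebra+)

lemma coble_in_cone:
  fixes u v :: "'k::field_char_0 triple"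
  assumes "biquad l m u v = 0"
  shows "coble_cone l m (coble u v)"
proof -
  obtain u1 u2 u3 v1 v2 v3 where uv: "u = (u1, u2, u3)" "v = (v1, v2, v3)"
    by (metis prod_cases3)
  note id = quartic_identity[of "u1 * v2" "u2 * v3" "u3 * v1" "u2 * v1" "u3 * v2" "u1 * v3"]
  have "coble u v 0 ^ 2 = (\<Sum>i=1..6. coble u v i ^ 4) - 1 / 4 * (\<Sum>i=1..6. coble u v i ^ 2) ^ 2"
    using id(3) unfolding uv coble.simps by (simp add: field_simps)
  moreover have "l * coble u v 0 - m * (\<Sum>i=1..6. coble u v i ^ 2) = 12 * biquad l m u v"
    unfolding uv coble.simps id(2) by (simp add: Let_def, algebra)
  ultimately show ?thesis
    using id(1) assms unfolding coble_cone_def uv coble.simps by simp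
qed

lemma biquad_from_cone:
  assumes "coble_cone l m (coble u v)"
  shows "biquad l m u (v :: 'k::field_char_0 triple) = 0"
proof -
  obtain u1 u2 u3 v1 v2 v3 where uv: "u = (u1, u2, u3)" "v = (v1, v2, v3)"
    by (metis prod_cases3)
  note id = quartic_identity[of "u1 * v2" "u2 * v3" "u3 * v1" "u2 * v1" "u3 * v2" "u1 * v3"]
  have "l * coble u v 0 - m * (\<Sum>i=1..6. coble u v i ^ 2) = 12 * biquad l m u v"
    unfolding uv coble.simps id(2) by (simp add: Let_def, algebra)
  with assms show ?thesis
    unfolding coble_cone_def by simp
qed

lemma coble_smul: "coble (smul c u) (smul d v) = wscale weights_2_1 (c * d) (coble u v)"
  by (cases u; cases v) (auto simp: fun_eq_iff wscale_def weights_2_1_def algebra_simps power2_eq_square)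

text \<open>The inverse of the projection from the cubic fourfold, defined where \<open>x\<^sub>1 + x\<^sub>2 + x\<^sub>3\<close> is nonzero: the shift
\<open>\<beta>\<close> is a root of a quadratic polynomial with that leading coefficient up to sign, and \<open>x\<^sub>0\<close> is a square root of
its discriminant, so it singles out one of the two roots.\<close>

lemma cubic_coords_recover:
  fixes x :: "nat \<Rightarrow> 'k::field_char_0"
  assumes sum: "(\<Sum>i=1..6. x i) = 0"
    and sq: "x 0 ^ 2 = (\<Sum>i=1..6. x i ^ 4) - 1 / 4 * (\<Sum>i=1..6. x i ^ 2) ^ 2"
    and s: "x 1 + x 2 + x 3 \<noteq> 0" and supp: "\<And>i. i > 6 \<Longrightarrow> x i = 0"
  obtains a1 a2 a3 b1 b2 b3 where "a1 * a2 * a3 = b1 * b2 * b3"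
    "cubic_coords (a1, a2, a3) (b1, b2, b3) = wscale weights_2_1 6 x"
    "a1 - b1 = x 1 - x 4 - (x 1 + x 2 + x 3)"
    "a1 - b2 = x 1 - x 5 - (x 1 + x 2 + x 3)"
    "a1 - b3 = x 1 - x 6 - (x 1 + x 2 + x 3)"
    "a2 - b1 = x 2 - x 4 - (x 1 + x 2 + x 3)"
    "a2 - b2 = x 2 - x 5 - (x 1 + x 2 + x 3)"
    "a2 - b3 = x 2 - x 6 - (x 1 + x 2 + x 3)"
    "a3 - b1 = x 3 - x 4 - (x 1 + x 2 + x 3)"
    "a3 - b2 = x 3 - x 5 - (x 1 + x 2 + x 3)"
    "a3 - b3 = x 3 - x 6 - (x 1 + x 2 + x 3)"
proof -
  define y1 y2 y3 y4 y5 y6 where y: "y1 = x 1" "y2 = x 2" "y3 = x 3" "y4 = x 4" "y5 = x 5" "y6 = x 6"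
  have sum': "y6 = - (y1 + y2 + y3 + y4 + y5)"
    using sum unfolding sum_1_6 y[symmetric] by algebra
  define \<sigma> where "\<sigma> = y1 + y2 + y3"
  define D where "D = (y1 * y2 + y2 * y3 + y1 * y3) - (y4 * y5 + y5 * y6 + y4 * y6)"
  define \<beta> where "\<beta> = (D - x 0 - \<sigma> ^ 2) / (2 * \<sigma>)"
  have \<sigma>: "\<sigma> \<noteq> 0"
    using s unfolding \<sigma>_def y .
  have \<beta>: "2 * \<sigma> * \<beta> = D - x 0 - \<sigma> ^ 2"
    using \<sigma> by (simp add: \<beta>_def)
  \<comment> \<open>Here \<open>\<beta>\<close> includes a shift by \<open>- \<sigma> / 2\<close>, so that the symmetric choice
     \<open>x\<^sub>i - \<sigma> / 2\<close>, \<open>x\<^sub>j + \<sigma> / 2\<close> of representatives appears without halves.\<close>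
  define a1 a2 a3 b1 b2 b3 where ab: "a1 = y1 + \<beta>" "a2 = y2 + \<beta>" "a3 = y3 + \<beta>"
    "b1 = y4 + \<sigma> + \<beta>" "b2 = y5 + \<sigma> + \<beta>" "b3 = y6 + \<sigma> + \<beta>"
  have sq': "4 * x 0 ^ 2 = 4 * (y1^4 + y2^4 + y3^4 + y4^4 + y5^4 + y6^4) - (y1^2+y2^2+y3^2+y4^2+y5^2+y6^2)^2"
    using sq unfolding sum_1_6 y by (simp add: field_simps)
  have "16 * \<sigma> * (a1 * a2 * a3 - b1 * b2 * b3) =
     4 * (y1^4 + y2^4 + y3^4 + y4^4 + y5^4 + y6^4) - (y1^2+y2^2+y3^2+y4^2+y5^2+y6^2)^2
     - 4 * (2 * \<sigma> * \<beta> + \<sigma> ^ 2 - D) ^ 2"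
    unfolding ab D_def \<sigma>_def sum' by algebra
  also have "\<dots> = 0"
    unfolding \<beta> sq'[symmetric] by algebra
  finally have cubic: "a1 * a2 * a3 = b1 * b2 * b3"
    using \<sigma> by simp
  have x0: "(a1 * a2 + a2 * a3 + a1 * a3) - (b1 * b2 + b2 * b3 + b1 * b3) = x 0"
  proof -
    have "(a1 * a2 + a2 * a3 + a1 * a3) - (b1 * b2 + b2 * b3 + b1 * b3) = D - \<sigma> ^ 2 - 2 * \<sigma> * \<beta>"
      unfolding ab D_def \<sigma>_def sum' by algebra
    then show ?thesis
      unfolding \<beta> by simp
  qed
  have A: "a1 + a2 + a3 = \<sigma> + 3 * \<beta>" "b1 + b2 + b3 = 2 * \<sigma> + 3 * \<beta>"
    unfolding ab \<sigma>_def sum' by algebra+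
  have "cubic_coords (a1, a2, a3) (b1, b2, b3) i = wscale weights_2_1 6 x i" for i
  proof -
    consider "i = 0" | "i = 1" | "i = 2" | "i = 3" | "i = 4" | "i = 5" | "i = 6" | "i > 6"
      by linarith
    then show ?thesis
      by cases (simp_all only: cubic_coords.simps A x0 wscale_def weights_2_1_def supp, simp_all add: ab y)
  qed
  then show thesis
    by (intro that[OF cubic]) (auto simp: ab \<sigma>_def y)
qed

definition triples :: "nat set set" where
  "triples = {S. S \<subseteq> {1..6} \<and> card S = 3}"

text \<open>A difference \<open>a\<^sub>i - b\<^sub>j\<close> is minus the sum of three coordinates of \<open>x\<close>.  If those sums are nonzero, then so
are all \<open>a\<^sub>i\<close> and \<open>b\<^sub>j\<close>, as a zero among the \<open>a\<^sub>i\<close> forces one among the \<open>b\<^sub>j\<close>; and six nonzero numbers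
with \<open>a\<^sub>1 a\<^sub>2 a\<^sub>3 = b\<^sub>1 b\<^sub>2 b\<^sub>3\<close> are the off-diagonal entries of a matrix of rank one.\<close>

lemma coble_recover:
  fixes x :: "nat \<Rightarrow> 'k::field_char_0"
  assumes cone: "coble_cone l m x" and supp: "\<And>i. i > 6 \<Longrightarrow> x i = 0"
    and gen: "\<And>S. S \<in> triples \<Longrightarrow> sum x S \<noteq> 0"
  obtains u1 u2 u3 v1 v2 v3 where "coble (u1, u2, u3) (v1, v2, v3) = wscale weights_2_1 6 x"
    "biquad l m (u1, u2, u3) (v1, v2, v3) = 0"
    "u1 \<noteq> 0" "u2 \<noteq> 0" "u3 \<noteq> 0" "v1 \<noteq> 0"
proof -
  have tri: "x i + x j + x k \<noteq> 0" if "i \<in> {1..6}" "j \<in> {1..6}" "k \<in> {1..6}" "i \<noteq> j" "j \<noteq> k" "i \<noteq> k" for i j k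
    using gen[of "{i, j, k}"] that by (simp add: triples_def add.assoc)
  have s: "x 1 + x 2 + x 3 \<noteq> 0"
    by (rule tri) auto
  obtain a1 a2 a3 b1 b2 b3 where cubic: "a1 * a2 * a3 = b1 * b2 * b3"
    and coords: "cubic_coords (a1, a2, a3) (b1, b2, b3) = wscale weights_2_1 6 x"
    and diff: "a1 - b1 = x 1 - x 4 - (x 1 + x 2 + x 3)"
    "a1 - b2 = x 1 - x 5 - (x 1 + x 2 + x 3)"
    "a1 - b3 = x 1 - x 6 - (x 1 + x 2 + x 3)"
    "a2 - b1 = x 2 - x 4 - (x 1 + x 2 + x 3)"
    "a2 - b2 = x 2 - x 5 - (x 1 + x 2 + x 3)"
    "a2 - b3 = x 2 - x 6 - (x 1 + x 2 + x 3)"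
    "a3 - b1 = x 3 - x 4 - (x 1 + x 2 + x 3)"
    "a3 - b2 = x 3 - x 5 - (x 1 + x 2 + x 3)"
    "a3 - b3 = x 3 - x 6 - (x 1 + x 2 + x 3)"
    using cubic_coords_recover[OF _ _ s supp] cone unfolding coble_cone_def by blast
  have t: "x 2 + x 3 + x 4 \<noteq> 0" "x 2 + x 3 + x 5 \<noteq> 0" "x 2 + x 3 + x 6 \<noteq> 0"
    "x 1 + x 3 + x 4 \<noteq> 0" "x 1 + x 3 + x 5 \<noteq> 0" "x 1 + x 3 + x 6 \<noteq> 0"
    "x 1 + x 2 + x 4 \<noteq> 0" "x 1 + x 2 + x 5 \<noteq> 0" "x 1 + x 2 + x 6 \<noteq> 0"
    by (rule tri; simp)+
  have "a1 - b1 = - (x 2 + x 3 + x 4)" "a1 - b2 = - (x 2 + x 3 + x 5)" "a1 - b3 = - (x 2 + x 3 + x 6)"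
    "a2 - b1 = - (x 1 + x 3 + x 4)" "a2 - b2 = - (x 1 + x 3 + x 5)" "a2 - b3 = - (x 1 + x 3 + x 6)"
    "a3 - b1 = - (x 1 + x 2 + x 4)" "a3 - b2 = - (x 1 + x 2 + x 5)" "a3 - b3 = - (x 1 + x 2 + x 6)"
    unfolding diff by algebra+
  with t have ne: "a1 \<noteq> b1" "a1 \<noteq> b2" "a1 \<noteq> b3" "a2 \<noteq> b1" "a2 \<noteq> b2" "a2 \<noteq> b3" "a3 \<noteq> b1" "a3 \<noteq> b2" "a3 \<noteq> b3"
    by (metis diff_self neg_equal_0_iff_equal)+
  have nz: "a1 \<noteq> 0" "a2 \<noteq> 0" "b1 \<noteq> 0" "b2 \<noteq> 0" "b3 \<noteq> 0"
    using cubic ne by auto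
  have a3: "a3 = b1 * b2 * b3 / (a1 * a2)"
    using cubic nz by (simp add: field_simps)
  have cob: "coble (1, a2 / b3, b2 / a1) (b1 * b3 / a2, a1, b3) = wscale weights_2_1 6 x"
  proof -
    have "1 * a1 = a1" "a2 / b3 * b3 = a2" "b2 / a1 * (b1 * b3 / a2) = a3"
        "a2 / b3 * (b1 * b3 / a2) = b1" "b2 / a1 * a1 = b2" "1 * b3 = b3"
      using nz by (simp_all add: a3)
    then show ?thesis
      unfolding coords[symmetric] coble.simps by (simp only:)
  qed
  have "coble_cone l m (wscale weights_2_1 6 x)"
    using cone unfolding coble_cone_def wscale_def weights_2_1_def sum_1_6
    by (simp add: power_mult_distrib) algebra
  then have "biquad l m (1, a2 / b3, b2 / a1) (b1 * b3 / a2, a1, b3) = 0"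
    unfolding cob[symmetric] by (rule biquad_from_cone)
  with cob show thesis
    by (rule that) (use nz in auto)
qed

section \<open>Smooth conics of the bundle\<close>

text \<open>Half the determinant of the Gram matrix of the conic over \<open>u\<close>.\<close>

definition conic_disc :: "'k::field \<Rightarrow> 'k \<Rightarrow> 'k triple \<Rightarrow> 'k" where
  "conic_disc l m u =
    (let m11 = biquad l m u (1, 0, 0); m22 = biquad l m u (0, 1, 0); m33 = biquad l m u (0, 0, 1);
         m12 = polar l m u (1, 0, 0) (0, 1, 0); m13 = polar l m u (1, 0, 0) (0, 0, 1);
         m23 = polar l m u (0, 1, 0) (0, 0, 1)
     in 4 * m11 * m22 * m33 + m12 * m13 * m23 - m11 * m23 ^ 2 - m22 * m13 ^ 2 - m33 * m12 ^ 2)"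

lemma biquad_expand:
  "biquad l m u (v1, v2, v3) = v1 ^ 2 * biquad l m u (1, 0, 0) + v2 ^ 2 * biquad l m u (0, 1, 0)
     + v3 ^ 2 * biquad l m u (0, 0, 1) + v1 * v2 * polar l m u (1, 0, 0) (0, 1, 0)
     + v1 * v3 * polar l m u (1, 0, 0) (0, 0, 1) + v2 * v3 * polar l m u (0, 1, 0) (0, 0, 1)"
proof -
  obtain u1 u2 u3 where u: "u = (u1, u2, u3)"
    by (metis prod_cases3)
  show ?thesis
    unfolding u polar_def Let_def biquad.simps add_Pair by algebra
qed

lemma ternary_singular:
  fixes m11 m22 m33 m12 m13 m23 :: "'k::field_char_0"
  assumes "2 * m11 * z1 + m12 * z2 + m13 * z3 = 0" "m12 * z1 + 2 * m22 * z2 + m23 * z3 = 0"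
    "m13 * z1 + m23 * z2 + 2 * m33 * z3 = 0" and "(z1, z2, z3) \<noteq> (0, 0, 0)"
  shows "4 * m11 * m22 * m33 + m12 * m13 * m23 - m11 * m23 ^ 2 - m22 * m13 ^ 2 - m33 * m12 ^ 2 = 0"
    (is "?d = 0")
proof -
  have "2 * ?d * z1 = 0" "2 * ?d * z2 = 0" "2 * ?d * z3 = 0"
    by (use assms(1-3) in algebra)+
  then show ?thesis
    using assms(4) by (metis mult_eq_0_iff zero_neq_numeral)
qed

text \<open>If a ternary quadratic form vanishes on the plane spanned by \<open>v = (0, p, q)\<close> and \<open>w\<close>, then its Gram matrix
maps \<open>v\<close> and \<open>w\<close> into the line orthogonal to that plane.  So a nontrivial combination of \<open>v\<close> and
\<open>w\<close> lies in the kernel.\<close>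

lemma ternary_isotropic_line:
  fixes m11 m22 m33 m12 m13 m23 :: "'k::field_char_0"
  assumes v: "m22 * p ^ 2 + m33 * q ^ 2 + m23 * p * q = 0" "(p, q) \<noteq> (0, 0)"
    and w: "m11 * w1 ^ 2 + m22 * w2 ^ 2 + m33 * w3 ^ 2 + m12 * w1 * w2 + m13 * w1 * w3 + m23 * w2 * w3 = 0" "w1 \<noteq> 0"
    and vw: "(m12 * p + m13 * q) * w1 + (2 * m22 * p + m23 * q) * w2 + (m23 * p + 2 * m33 * q) * w3 = 0"
  shows "4 * m11 * m22 * m33 + m12 * m13 * m23 - m11 * m23 ^ 2 - m22 * m13 ^ 2 - m33 * m12 ^ 2 = 0"
proof -
  define X1 X2 X3 where X: "X1 = m12 * p + m13 * q" "X2 = 2 * m22 * p + m23 * q" "X3 = m23 * p + 2 * m33 * q"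
  define Y1 Y2 Y3 where Y: "Y1 = 2 * m11 * w1 + m12 * w2 + m13 * w3" "Y2 = m12 * w1 + 2 * m22 * w2 + m23 * w3"
    "Y3 = m13 * w1 + m23 * w2 + 2 * m33 * w3"
  have "X2 * p + X3 * q = 2 * (m22 * p ^ 2 + m33 * q ^ 2 + m23 * p * q)"
    unfolding X by algebra
  then have Xv: "X2 * p + X3 * q = 0"
    unfolding v(1) by simp
  have Xw: "X1 * w1 + X2 * w2 + X3 * w3 = 0"
    unfolding X by (rule vw)
  have "Y2 * p + Y3 * q = (m12 * p + m13 * q) * w1 + (2 * m22 * p + m23 * q) * w2 + (m23 * p + 2 * m33 * q) * w3"
    unfolding Y by algebra
  then have Yv: "Y2 * p + Y3 * q = 0"
    unfolding vw .
  have "Y1 * w1 + Y2 * w2 + Y3 * w3 =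
      2 * (m11 * w1 ^ 2 + m22 * w2 ^ 2 + m33 * w3 ^ 2 + m12 * w1 * w2 + m13 * w1 * w3 + m23 * w2 * w3)"
    unfolding Y by algebra
  then have Yw: "Y1 * w1 + Y2 * w2 + Y3 * w3 = 0"
    unfolding w(1) by simp
  have par: "X2 * Y3 = X3 * Y2"
  proof (cases "p = 0")
    case True
    then show ?thesis using Xv Yv v(2) by simp
  next
    case False
    have "p * (X2 * Y3 - X3 * Y2) = 0"
      using Xv Yv by algebra
    then show ?thesis using False by simp
  qed
  then have par1: "X1 * Y3 = X3 * Y1" "X1 * Y2 = X2 * Y1"
  proof -
    have "w1 * (X1 * Y3 - X3 * Y1) = 0" "w1 * (X1 * Y2 - X2 * Y1) = 0"
      by (use Xw Yw par in algebra)+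
    then show "X1 * Y3 = X3 * Y1" "X1 * Y2 = X2 * Y1"
      using w(2) by simp_all
  qed
  show ?thesis
  proof (cases "X2 = 0 \<and> X3 = 0")
    case True
    then have "X1 = 0"
      using Xw w(2) by simp
    then show ?thesis
      using ternary_singular[of m11 0 m12 p m13 q m22 m23 m33] True v(2) unfolding X by simp
  next
    case False
    then obtain x y where xy: "x \<noteq> 0" "y * X1 = x * Y1" "y * X2 = x * Y2" "y * X3 = x * Y3"
      using par par1 by (metis mult.commute)
    then have "(- x * w1, y * p - x * w2, y * q - x * w3) \<noteq> (0, 0, 0)"
      using w(2) by simp
    moreover have "2 * m11 * (- x * w1) + m12 * (y * p - x * w2) + m13 * (y * q - x * w3) = 0"
        "m12 * (- x * w1) + 2 * m22 * (y * p - x * w2) + m23 * (y * q - x * w3) = 0"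
        "m13 * (- x * w1) + m23 * (y * p - x * w2) + 2 * m33 * (y * q - x * w3) = 0"
      by (use xy(2-4)[unfolded X Y] in algebra)+
    ultimately show ?thesis
      by (intro ternary_singular)
  qed
qed

text \<open>A smooth conic contains no line, so two distinct points of it are not conjugate.\<close>

lemma polar_nonzero:
  fixes u :: "'k::field_char_0 triple"
  assumes disc: "conic_disc l m u \<noteq> 0"
    and v: "biquad l m u (0, p, q) = 0" "(p, q) \<noteq> (0, 0)"
    and w: "biquad l m u (w1, w2, w3) = 0" "w1 \<noteq> 0"
  shows "polar l m u (0, p, q) (w1, w2, w3) \<noteq> 0"
proof
  assume 0: "polar l m u (0, p, q) (w1, w2, w3) = 0"
  let ?m11 = "biquad l m u (1, 0, 0)" and ?m22 = "biquad l m u (0, 1, 0)" and ?m33 = "biquad l m u (0, 0, 1)"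
  let ?m12 = "polar l m u (1, 0, 0) (0, 1, 0)" and ?m13 = "polar l m u (1, 0, 0) (0, 0, 1)"
  let ?m23 = "polar l m u (0, 1, 0) (0, 0, 1)"
  have "?m22 * p ^ 2 + ?m33 * q ^ 2 + ?m23 * p * q = 0"
    using biquad_expand[of l m u 0 p q] v(1) by (simp add: mult_ac)
  moreover have "?m11 * w1 ^ 2 + ?m22 * w2 ^ 2 + ?m33 * w3 ^ 2 + ?m12 * w1 * w2 + ?m13 * w1 * w3 + ?m23 * w2 * w3 = 0"
    using biquad_expand[of l m u w1 w2 w3] w(1) by (simp add: mult_ac)
  moreover have "(?m12 * p + ?m13 * q) * w1 + (2 * ?m22 * p + ?m23 * q) * w2 + (?m23 * p + 2 * ?m33 * q) * w3 = 0"
  proof -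
    have "(?m12 * p + ?m13 * q) * w1 + (2 * ?m22 * p + ?m23 * q) * w2 + (?m23 * p + 2 * ?m33 * q) * w3 =
        biquad l m u (w1, p + w2, q + w3) - biquad l m u (0, p, q) - biquad l m u (w1, w2, w3)"
      unfolding biquad_expand[of l m u w1 "p + w2" "q + w3"] biquad_expand[of l m u w1 w2 w3]
        biquad_expand[of l m u 0 p q] by (simp add: algebra_simps power2_eq_square)
    also have "\<dots> = 0"
      using 0 by (simp add: polar_def)
    finally show ?thesis .
  qed
  ultimately have "conic_disc l m u = 0"
    unfolding conic_disc_def Let_def using ternary_isotropic_line[OF _ v(2) _ w(2)] by blast
  with disc show False by simp
qed

lemma hom_poly_biquad:
  fixes u1 u2 u3 v1 v2 v3 :: "(nat \<Rightarrow> 'k::field) \<Rightarrow> 'k"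
  assumes "hom_poly I w d u1" "hom_poly I w d u2" "hom_poly I w d u3"
    "hom_poly I w e v1" "hom_poly I w e v2" "hom_poly I w e v3" "k = 2 * (d + e)"
  shows "hom_poly I w k (\<lambda>y. biquad l m (u1 y, u2 y, u3 y) (v1 y, v2 y, v3 y))"
  unfolding biquad.simps Let_def
  by (rule assms(1-6) hom_poly_scale hom_poly_diff hom_poly_add hom_poly_power hom_poly_mult refl | simp add: assms(7))+

lemma hom_poly_polar:
  fixes u1 u2 u3 v1 v2 v3 :: "(nat \<Rightarrow> 'k::field) \<Rightarrow> 'k"
  assumes "hom_poly I w d u1" "hom_poly I w d u2" "hom_poly I w d u3"
    "hom_poly I w e v1" "hom_poly I w e v2" "hom_poly I w e v3"
    "hom_poly I w e w1" "hom_poly I w e w2" "hom_poly I w e w3" "k = 2 * (d + e)"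
  shows "hom_poly I w k (\<lambda>y. polar l m (u1 y, u2 y, u3 y) (v1 y, v2 y, v3 y) (w1 y, w2 y, w3 y))"
  unfolding polar_def add_Pair
  by (intro hom_poly_diff hom_poly_biquad[where d = d and e = e] hom_poly_add assms)

lemma hom_poly_coble:
  fixes u1 u2 u3 v1 v2 v3 :: "(nat \<Rightarrow> 'k::field) \<Rightarrow> 'k"
  assumes "hom_poly I w d u1" "hom_poly I w d u2" "hom_poly I w d u3"
    "hom_poly I w e v1" "hom_poly I w e v2" "hom_poly I w e v3"
  shows "hom_poly I w ((d + e) * weights_2_1 i) (\<lambda>y. coble (u1 y, u2 y, u3 y) (v1 y, v2 y, v3 y) i)"
proof -
  have if_rule: "hom_poly I w k (\<lambda>y. if b then f y else g y)"
    if "hom_poly I w k f" "hom_poly I w k g" for b k and f g :: "(nat \<Rightarrow> 'k) \<Rightarrow> 'k"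
    using that by (cases b) simp_all
  show ?thesis
  proof (cases "i = 0")
    case True
    show ?thesis
      unfolding True coble.simps cubic_coords.simps simp_thms if_True weights_2_1_def
      by (rule assms hom_poly_scale hom_poly_diff hom_poly_add hom_poly_mult refl | simp)+
  next
    case False
    have "(d + e) * weights_2_1 i = d + e"
      using False by (simp add: weights_2_1_def)
    then show ?thesis
      unfolding coble.simps cubic_coords.simps if_not_P[OF False]
      by (simp only:) (rule assms if_rule hom_poly_scale hom_poly_diff hom_poly_add hom_poly_zero hom_poly_mult refl | simp)+
  qed
qed

lemma plane_poly_biquad:
  fixes u1 u2 u3 v1 v2 v3 :: "'k::field_char_0 \<Rightarrow> 'k \<Rightarrow> 'k"
  assumes "plane_poly u1" "plane_poly u2" "plane_poly u3" "plane_poly v1" "plane_poly v2" "plane_poly v3"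
  shows "plane_poly (\<lambda>s z. biquad l m (u1 s z, u2 s z, u3 s z) (v1 s z, v2 s z, v3 s z))"
  unfolding biquad.simps Let_def by (intro plane_poly_intros assms)

lemma plane_poly_coble:
  fixes u1 u2 u3 v1 v2 v3 :: "'k::field_char_0 \<Rightarrow> 'k \<Rightarrow> 'k"
  assumes "plane_poly u1" "plane_poly u2" "plane_poly u3" "plane_poly v1" "plane_poly v2" "plane_poly v3"
  shows "plane_poly (\<lambda>s z. coble (u1 s z, u2 s z, u3 s z) (v1 s z, v2 s z, v3 s z) i)"
proof -
  have if_rule: "plane_poly (\<lambda>s z. if b then f s z else g s z)"
    if "plane_poly f" "plane_poly g" for b and f g :: "'k \<Rightarrow> 'k \<Rightarrow> 'k"
    using that by (cases b) simp_all
  show ?thesis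
    unfolding coble.simps cubic_coords.simps by (intro if_rule plane_poly_intros assms)
qed

section \<open>The parametrization obtained from a rational multisection\<close>

lemma biquad_not_identically_zero:
  fixes u1 u2 u3 :: "'k::field_char_0"
  assumes lm: "l \<noteq> 0 \<or> m \<noteq> 0" and u: "u1 \<noteq> 0" "u2 \<noteq> 0" "u3 \<noteq> 0" "\<not> (u1 = u2 \<and> u2 = u3)"
  shows "\<exists>v. biquad l m (u1, u2, u3) v \<noteq> 0"
proof (rule ccontr)
  assume "\<not> ?thesis"
  then have z: "biquad l m (u1, u2, u3) v = 0" for v
    by blast
  show False
  proof (cases "m = 0")
    case True
    then have "u1 * (u2 - u3) = 0" "u2 * (u3 - u1) = 0"
      using lm z[of "(0, 1, 1)"] z[of "(1, 0, 1)"] by (simp_all add: Let_def algebra_simps)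
    then show False
      using u by auto
  next
    case False
    have "m * 4 * (u3 ^ 2 - u3 * u2 + u2 ^ 2) = 0" "m * 4 * (u1 ^ 2 - u1 * u3 + u3 ^ 2) = 0"
        "m * 4 * (u2 ^ 2 - u2 * u1 + u1 ^ 2) = 0"
      using z[of "(1, 0, 0)"] z[of "(0, 1, 0)"] z[of "(0, 0, 1)"] by (simp_all add: Let_def algebra_simps)
    then have "u3 ^ 2 - u3 * u2 + u2 ^ 2 = 0" "u1 ^ 2 - u1 * u3 + u3 ^ 2 = 0" "u2 ^ 2 - u2 * u1 + u1 ^ 2 = 0"
      using False by (metis mult_eq_0_iff zero_neq_numeral)+
    then have "u3 ^ 3 = - (u2 ^ 3)" "u1 ^ 3 = - (u3 ^ 3)" "u2 ^ 3 = - (u1 ^ 3)"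
      by algebra+
    then show False
      using u by simp
  qed
qed

text \<open>The data of a rational multisection of the conic bundle: a family, with eight homogeneous parameters, of
points \<open>u\<close> and points \<open>(0, p, q)\<close> on the conic over \<open>u\<close>.  The first three parameters are reserved for the
direction in which the conic is projected.  The polynomial \<open>h\<close> defines the exceptional locus: where it is
nonzero the conic is smooth and \<open>u\<close> is reached by the family, with any prescribed direction.\<close>

locale coble_parametrization =
  fixes l m :: "'k::{alg_closed_field,field_char_0}"
    and u1 u2 u3 p q :: "(nat \<Rightarrow> 'k) \<Rightarrow> 'k" and h :: "'k triple \<Rightarrow> 'k" and e :: nat
  assumes lm: "l \<noteq> 0 \<or> m \<noteq> 0"
    and hom_u: "hom_poly {..7} (\<lambda>_. 1) e u1" "hom_poly {..7} (\<lambda>_. 1) e u2" "hom_poly {..7} (\<lambda>_. 1) e u3"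
    and hom_pq: "hom_poly {..7} (\<lambda>_. 1) 1 p" "hom_poly {..7} (\<lambda>_. 1) 1 q"
    and section_on: "\<And>y. biquad l m (u1 y, u2 y, u3 y) (0, p y, q y) = 0"
    and h_poly: "\<And>a1 a2 a3 b1 b2 b3. plane_poly (\<lambda>s z. h (a1 + s * b1, a2 + s * b2, a3 + s * b3))"
    and h_nonzero: "\<exists>u. h u \<noteq> 0"
    and h_disc: "\<And>u. h u \<noteq> 0 \<Longrightarrow> conic_disc l m u \<noteq> 0"
    and lift: "\<And>u w1 w2 w3. h u \<noteq> 0 \<Longrightarrow> \<exists>y c. (\<forall>i. i \<notin> {..7} \<longrightarrow> y i = 0) \<and> c \<noteq> 0 \<and>
       (y 0, y 1, y 2) = (w1, w2, w3) \<and> (u1 y, u2 y, u3 y) = smul c u \<and> (p y, q y) \<noteq> (0, 0)"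
begin

abbreviation u_at :: "(nat \<Rightarrow> 'k) \<Rightarrow> 'k triple" where "u_at y \<equiv> (u1 y, u2 y, u3 y)"
abbreviation v0_at :: "(nat \<Rightarrow> 'k) \<Rightarrow> 'k triple" where "v0_at y \<equiv> (0, p y, q y)"
abbreviation w_at :: "(nat \<Rightarrow> 'k) \<Rightarrow> 'k triple" where "w_at y \<equiv> (y 0, y 1, y 2)"

text \<open>The residual intersection of the conic over \<open>u\<close> with the line through the points \<open>v0_at\<close> and
\<open>w_at\<close>.\<close>

definition v_at :: "(nat \<Rightarrow> 'k) \<Rightarrow> 'k triple" where
  "v_at y = smul (biquad l m (u_at y) (w_at y)) (v0_at y) + smul (- polar l m (u_at y) (v0_at y) (w_at y)) (w_at y)"

definition \<Psi> :: "(nat \<Rightarrow> 'k) \<Rightarrow> nat \<Rightarrow> 'k" where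
  "\<Psi> y = coble (u_at y) (v_at y)"

lemma \<Psi>_in_cone: "coble_cone l m (\<Psi> y)"
proof -
  have "biquad l m (u_at y) (v_at y) = 0"
    unfolding v_at_def biquad_combine section_on by (simp add: power2_eq_square)
  then show ?thesis
    unfolding \<Psi>_def by (rule coble_in_cone)
qed

lemma hom_\<Psi>: "hom_poly {..7} (\<lambda>_. 1) ((3 * e + 3) * weights_2_1 i) (\<lambda>y. \<Psi> y i)"
proof -
  have w: "hom_poly {..7} (\<lambda>_. 1) 1 (\<lambda>y::nat \<Rightarrow> 'k. y 0)" "hom_poly {..7} (\<lambda>_. 1) 1 (\<lambda>y::nat \<Rightarrow> 'k. y 1)"
      "hom_poly {..7} (\<lambda>_. 1) 1 (\<lambda>y::nat \<Rightarrow> 'k. y 2)"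
    by (rule hom_poly_var; simp)+
  have b: "hom_poly {..7} (\<lambda>_. 1) (2 * (e + 1)) (\<lambda>y. biquad l m (u_at y) (w_at y))"
    by (rule hom_poly_biquad[OF hom_u w refl])
  have r: "hom_poly {..7} (\<lambda>_. 1) (2 * (e + 1)) (\<lambda>y. - polar l m (u_at y) (v0_at y) (w_at y))"
    by (intro hom_poly_uminus hom_poly_polar[OF hom_u hom_poly_zero hom_pq w refl])
  have v: "hom_poly {..7} (\<lambda>_. 1) (2 * e + 3) (\<lambda>y. biquad l m (u_at y) (w_at y) * f y + - polar l m (u_at y) (v0_at y) (w_at y) * g y)"
    if "hom_poly {..7} (\<lambda>_. 1) 1 f" "hom_poly {..7} (\<lambda>_. 1) 1 g" for f g
    by (intro hom_poly_add hom_poly_mult[OF b that(1)] hom_poly_mult[OF r that(2)]) simp_all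
  have "3 * e + 3 = e + (2 * e + 3)"
    by simp
  then show ?thesis
    unfolding \<Psi>_def v_at_def smul_simp add_Pair
    by (simp only:) (intro hom_poly_coble hom_u v hom_poly_zero hom_pq w)
qed

lemma \<Psi>_supp: "i > 6 \<Longrightarrow> \<Psi> y i = 0"
  unfolding \<Psi>_def v_at_def smul_simp add_Pair by simp

text \<open>A point of the conic is its own residual intersection: the line through \<open>v0_at\<close> and a second point \<open>w\<close> of
the conic meets it again in \<open>w\<close>.  The condition on the first coordinate says that \<open>w\<close> is not
\<open>v0_at\<close>.\<close>

lemma \<Psi>_hits:
  assumes h: "h u \<noteq> 0" and v: "biquad l m u (w1, w2, w3) = 0" "w1 \<noteq> 0"
  obtains y k where "y \<in> nonzero_vecs {..7}" "k \<noteq> 0" "\<Psi> y = wscale weights_2_1 k (coble u (w1, w2, w3))"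
proof -
  obtain y c where y: "\<forall>i. i \<notin> {..7} \<longrightarrow> y i = 0" "c \<noteq> 0" "w_at y = (w1, w2, w3)"
      "u_at y = smul c u" "(p y, q y) \<noteq> (0, 0)"
    using lift[OF h] by blast
  have nz: "y \<in> nonzero_vecs {..7}"
    using y(1,3) v(2) by (auto simp: nonzero_vecs_def intro!: bexI[of _ 0])
  have "biquad l m u (v0_at y) = 0"
    using section_on[of y] y(2) unfolding y(4) biquad_smul by simp
  then have pol: "polar l m u (v0_at y) (w1, w2, w3) \<noteq> 0"
    using polar_nonzero[OF h_disc[OF h]] y(5) v by blast
  define k where "k = - polar l m (u_at y) (v0_at y) (w1, w2, w3)"
  have k: "k \<noteq> 0"
    using pol y(2) unfolding k_def y(4) polar_smul by simp
  have "v_at y = smul k (w1, w2, w3)"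
    unfolding v_at_def y(3) y(4) biquad_smul v(1) k_def by simp
  then have "\<Psi> y = wscale weights_2_1 (c * k) (coble u (w1, w2, w3))"
    unfolding \<Psi>_def y(4) using coble_smul by metis
  then show thesis
    using that[OF nz] k y(2) by (metis mult_eq_0_iff)
qed

text \<open>Move \<open>u\<close> along a line to a point where \<open>h\<close> is nonzero, and \<open>v\<close> along a line that is not contained in the
conic over the initial \<open>u\<close>.  The pairs on the divisor of bidegree \<open>(2, 2)\<close> form a plane curve, and the
image contains its points with \<open>h u \<noteq> 0\<close>, apart from those where the first coordinate of \<open>v\<close> or
\<open>\<sigma>\<close> is zero.  These two functions do not vanish at the given point, so they may be put into the
polynomial that is shown to vanish.\<close>

theorem \<Psi>_dense:
  assumes F: "F \<in> whomog {0..6} weights_2_1 d"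
    and van: "\<And>y. y \<in> nonzero_vecs {..7} \<Longrightarrow> \<exists>i\<in>{1..6}. \<Psi> y i \<noteq> 0 \<Longrightarrow> mpol_eval F (\<Psi> y) = 0"
    and cone: "coble_cone l m x" and supp: "\<And>i. i > 6 \<Longrightarrow> x i = 0"
    and gen: "\<And>S. S \<in> triples \<Longrightarrow> sum x S \<noteq> 0"
  shows "mpol_eval F x = 0"
proof -
  obtain a1 a2 a3 b1 b2 b3 where rec: "coble (a1, a2, a3) (b1, b2, b3) = wscale weights_2_1 6 x"
    "biquad l m (a1, a2, a3) (b1, b2, b3) = 0" "a1 \<noteq> 0" "a2 \<noteq> 0" "a3 \<noteq> 0" "b1 \<noteq> 0"
    by (rule coble_recover[OF cone supp gen])
  define \<sigma> where "\<sigma> u v = coble u v 1 + coble u v 2 + coble u v 3" for u v :: "'k triple"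
  have \<sigma>0: "\<sigma> (a1, a2, a3) (b1, b2, b3) \<noteq> 0"
  proof -
    have "\<sigma> (a1, a2, a3) (b1, b2, b3) = 6 * sum x {1, 2, 3}"
      unfolding \<sigma>_def rec(1) wscale_def weights_2_1_def by (simp add: distrib_left)
    moreover have "sum x {1, 2, 3} \<noteq> 0"
      by (rule gen) (auto simp: triples_def)
    ultimately show ?thesis
      by (metis mult_eq_0_iff zero_neq_numeral)
  qed
  have "\<not> (a1 = a2 \<and> a2 = a3)"
    using \<sigma>0 by (auto simp: \<sigma>_def algebra_simps)
  then obtain c where c: "biquad l m (a1, a2, a3) c \<noteq> 0"
    using biquad_not_identically_zero[OF lm rec(3-5)] by blast
  obtain c1 c2 c3 where c_eq: "c = (c1, c2, c3)"
    by (metis prod_cases3)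
  obtain g1 g2 g3 where g: "h (g1, g2, g3) \<noteq> 0"
    using h_nonzero by (metis prod_cases3)
  define u where "u s = (a1 + s * (g1 - a1), a2 + s * (g2 - a2), a3 + s * (g3 - a3))" for s
  define v where "v z = (b1 + z * (c1 - b1), b2 + z * (c2 - b2), b3 + z * (c3 - b3))" for z
  \<comment> \<open>The first two factors remove the points of the curve that the parametrization may miss.\<close>
  define f where "f s z = (b1 + z * (c1 - b1)) * \<sigma> (u s) (v z) * mpol_eval F (coble (u s) (v z))" for s z
  note pp = plane_poly_intros
  have "f 0 0 = 0"
  proof (rule density_along_plane_curve[where P = "\<lambda>s z. biquad l m (u s) (v z)" and h = "\<lambda>s z. h (u s)"
        and ?s1.0 = 1 and ?z1.0 = 1 and ?z0.0 = 0 and f = f])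
    show "plane_poly (\<lambda>s z. biquad l m (u s) (v z))"
      unfolding u_def v_def by (intro plane_poly_biquad pp)
    show "plane_poly f"
      unfolding f_def \<sigma>_def u_def v_def
      by (intro pp plane_poly_mpol_eval plane_poly_coble)
    show "plane_poly (\<lambda>s z. h (u s))"
      unfolding u_def by (rule h_poly)
    show "h (u 1) \<noteq> 0"
      using g by (simp add: u_def)
    show "biquad l m (u 0) (v 1) \<noteq> 0" "biquad l m (u 0) (v 0) = 0"
      using c rec(2) by (simp_all add: u_def v_def c_eq del: biquad.simps)
    fix s z assume on: "biquad l m (u s) (v z) = 0"
    show "h (u s) * f s z = 0"
    proof (rule ccontr)
      assume "\<not> ?thesis"
      then have nz: "h (u s) \<noteq> 0" "b1 + z * (c1 - b1) \<noteq> 0" "\<sigma> (u s) (v z) \<noteq> 0"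
          "mpol_eval F (coble (u s) (v z)) \<noteq> 0"
        by (auto simp: f_def)
      obtain y k where y: "y \<in> nonzero_vecs {..7}" "k \<noteq> 0" "\<Psi> y = wscale weights_2_1 k (coble (u s) (v z))"
        using \<Psi>_hits[OF nz(1) on[unfolded v_def] nz(2)] unfolding v_def by blast
      have "\<exists>i\<in>{1..6}. coble (u s) (v z) i \<noteq> 0"
      proof (rule ccontr)
        assume "\<not> ?thesis"
        then have "\<sigma> (u s) (v z) = 0"
          unfolding \<sigma>_def by simp
        with nz(3) show False by simp
      qed
      then have "\<exists>i\<in>{1..6}. \<Psi> y i \<noteq> 0"
        using y(2) unfolding y(3) wscale_def by auto
      then have "mpol_eval F (\<Psi> y) = 0"
        using van y(1) by blast
      then show False
        using mpol_eval_wscale[OF F] y(2,3) nz(4) by simp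
    qed
  qed simp
  then have "mpol_eval F (wscale weights_2_1 6 x) = 0"
    using \<sigma>0 rec(1,6) by (simp add: f_def u_def v_def del: coble.simps)
  then show ?thesis
    using mpol_eval_wscale[OF F] by simp
qed

end

section \<open>Rational multisections\<close>

lemma quadratic_root:
  fixes a b c :: "'k::alg_closed_field"
  assumes "a \<noteq> 0"
  obtains x where "a * x ^ 2 + b * x + c = 0"
proof -
  have "\<exists>x. poly [:c, b, a:] x = 0"
    using assms by (intro alg_closed_imp_poly_has_root) simp
  then show ?thesis
    using that by (auto simp: algebra_simps power2_eq_square)
qed

lemma plane_poly_conic_disc:
  fixes a1 a2 a3 b1 b2 b3 :: "'k::field_char_0"
  shows "plane_poly (\<lambda>s z. conic_disc l m (a1 + s * b1, a2 + s * b2, a3 + s * b3))"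
  unfolding conic_disc_def Let_def polar_def add_Pair
  by (intro plane_poly_biquad plane_poly_intros)

lemma hom_var: "i \<le> 7 \<Longrightarrow> hom_poly {..7} (\<lambda>_. 1) 1 (\<lambda>y. y i)"
  by (rule hom_poly_var) simp_all

definition params :: "'k triple \<Rightarrow> 'k triple \<Rightarrow> 'k \<Rightarrow> 'k \<Rightarrow> nat \<Rightarrow> 'k::zero" where
  "params w r p q i = (case w of (w1, w2, w3) \<Rightarrow> case r of (r1, r2, r3) \<Rightarrow>
     if i < 8 then [w1, w2, w3, r1, r2, r3, p, q] ! i else 0)"

lemma params_simps [simp]:
  "params (w1, w2, w3) (r1, r2, r3) p q 0 = w1" "params (w1, w2, w3) (r1, r2, r3) p q (Suc 0) = w2"
  "params (w1, w2, w3) (r1, r2, r3) p q 2 = w3" "params (w1, w2, w3) (r1, r2, r3) p q 3 = r1"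
  "params (w1, w2, w3) (r1, r2, r3) p q 4 = r2" "params (w1, w2, w3) (r1, r2, r3) p q 5 = r3"
  "params (w1, w2, w3) (r1, r2, r3) p q 6 = p" "params (w1, w2, w3) (r1, r2, r3) p q 7 = q"
  by (simp_all add: params_def)

lemma params_supp: "i \<notin> {..7} \<Longrightarrow> params w r p q i = 0"
  by (auto simp: params_def split: prod.splits)

text \<open>For \<open>m = 0\<close> all conics pass through the coordinate points, and \<open>(0, 1, 0)\<close> is a section.  It is scaled by
\<open>u\<^sub>1\<close> to have degree one.\<close>

lemma parametrization_igusa:
  fixes l :: "'k::{alg_closed_field,field_char_0}"
  assumes l: "l \<noteq> 0"
  shows "coble_parametrization l 0 (\<lambda>y. y 3) (\<lambda>y. y 4) (\<lambda>y. y 5) (\<lambda>y. y 3) (\<lambda>y. 0)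
    (\<lambda>u. fst u * conic_disc l 0 u) 1"
proof
  show "\<exists>u. fst u * conic_disc l 0 u \<noteq> 0"
    using l by (intro exI[of _ "(1, 2, 3)"])
      (simp add: conic_disc_def Let_def polar_def algebra_simps power2_eq_square)
  fix u :: "'k triple" and w1 w2 w3 :: 'k
  assume h: "fst u * conic_disc l 0 u \<noteq> 0"
  obtain u1 u2 u3 where u: "u = (u1, u2, u3)"
    by (metis prod_cases3)
  show "\<exists>(y :: nat \<Rightarrow> 'k) c. (\<forall>i. i \<notin> {..7} \<longrightarrow> y i = 0) \<and> c \<noteq> 0 \<and> (y 0, y 1, y 2) = (w1, w2, w3) \<and>
      (y 3, y 4, y 5) = smul c u \<and> (y 3, 0) \<noteq> (0, 0)"
    using h u by (intro exI[of _ "params (w1, w2, w3) u 0 0"] exI[of _ 1]) (simp add: params_supp)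
next
  fix a1 a2 a3 b1 b2 b3
  show "plane_poly (\<lambda>s z. fst (a1 + s * b1, a2 + s * b2, a3 + s * b3) * conic_disc l 0 (a1 + s * b1, a2 + s * b2, a3 + s * b3))"
    unfolding fst_conv by (intro plane_poly_intros plane_poly_conic_disc)
next
  show "hom_poly {..7} (\<lambda>_. 1) 1 (\<lambda>y. y 3 :: 'k)" "hom_poly {..7} (\<lambda>_. 1) 1 (\<lambda>y. y 4 :: 'k)"
      "hom_poly {..7} (\<lambda>_. 1) 1 (\<lambda>y. y 5 :: 'k)"
      "hom_poly {..7} (\<lambda>_. 1) 1 (\<lambda>y. 0 :: 'k)"
    by (rule hom_var hom_poly_zero; simp)+
qed (use l in simp_all)

text \<open>For \<open>l = 2 m\<close> the two points on the line \<open>v\<^sub>1 = 0\<close> are the zeros of linear forms in \<open>(p, q)\<close>: with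
\<open>x = u\<^sub>1 p\<close>, \<open>y = u\<^sub>2 q\<close>, \<open>z = u\<^sub>3 p + u\<^sub>1 q\<close> the equation is
\<open>x\<^sup>2 + y\<^sup>2 + z\<^sup>2 - x y - x z - y z = 0\<close>.\<close>

lemma burkhardt_split:
  fixes m \<omega> :: "'k::field"
  assumes \<omega>: "\<omega> ^ 2 + \<omega> + 1 = 0"
  shows "biquad (2 * m) m (u1, u2, u3) (0, p, q) = - 4 * m *
    (u1 * p + \<omega> * (u2 * q) + \<omega> ^ 2 * (u3 * p + u1 * q)) *
    (u1 * p + \<omega> ^ 2 * (u2 * q) + \<omega> * (u3 * p + u1 * q))"
  unfolding biquad.simps Let_def using \<omega> by algebra

text \<open>The section is the zero of the first linear factor.\<close>

lemma parametrization_burkhardt: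
  fixes m \<omega> :: "'k::{alg_closed_field,field_char_0}"
  assumes m: "m \<noteq> 0" and \<omega>: "\<omega> ^ 2 + \<omega> + 1 = 0"
  shows "coble_parametrization (2 * m) m (\<lambda>y. y 3) (\<lambda>y. y 4) (\<lambda>y. y 5)
    (\<lambda>y. \<omega> * y 4 + \<omega> ^ 2 * y 3) (\<lambda>y. - (y 3 + \<omega> ^ 2 * y 5))
    (\<lambda>u. (\<omega> * fst (snd u) + \<omega> ^ 2 * fst u) * conic_disc (2 * m) m u) 1"
proof
  have "\<omega> \<noteq> 1"
    using \<omega> by auto
  moreover have "\<omega> * 2 + \<omega> ^ 2 = \<omega> - 1"
    using \<omega> by algebra
  ultimately have "\<omega> * 2 + \<omega> ^ 2 \<noteq> 0"
    by (metis eq_iff_diff_eq_0)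
  moreover have "conic_disc (2 * m) m (1, 2, 3) = 6912 * m ^ 3"
    by (simp add: conic_disc_def Let_def polar_def) algebra
  ultimately show "\<exists>u. (\<omega> * fst (snd u) + \<omega> ^ 2 * fst u) * conic_disc (2 * m) m u \<noteq> 0"
    using m by (intro exI[of _ "(1, 2, 3)"]) simp
  fix y :: "nat \<Rightarrow> 'k"
  let ?p = "\<omega> * y 4 + \<omega> ^ 2 * y 3" and ?q = "- (y 3 + \<omega> ^ 2 * y 5)"
  have split: "y 3 * ?p + \<omega> * (y 4 * ?q) + \<omega> ^ 2 * (y 5 * ?p + y 3 * ?q) = 0"
    by (simp add: algebra_simps)
  show "biquad (2 * m) m (y 3, y 4, y 5) (0, ?p, ?q) = 0"
    unfolding burkhardt_split[OF \<omega>] split by simp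
next
  fix u :: "'k triple" and w1 w2 w3 :: 'k
  assume h: "(\<omega> * fst (snd u) + \<omega> ^ 2 * fst u) * conic_disc (2 * m) m u \<noteq> 0"
  obtain u1 u2 u3 where u: "u = (u1, u2, u3)"
    by (metis prod_cases3)
  show "\<exists>(y :: nat \<Rightarrow> 'k) c. (\<forall>i. i \<notin> {..7} \<longrightarrow> y i = 0) \<and> c \<noteq> 0 \<and> (y 0, y 1, y 2) = (w1, w2, w3) \<and>
      (y 3, y 4, y 5) = smul c u \<and> (\<omega> * y 4 + \<omega> ^ 2 * y 3, - (y 3 + \<omega> ^ 2 * y 5)) \<noteq> (0, 0)"
    using h u by (intro exI[of _ "params (w1, w2, w3) u 0 0"] exI[of _ 1]) (simp add: params_supp)
next
  fix a1 a2 a3 b1 b2 b3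
  show "plane_poly (\<lambda>s z. (\<omega> * fst (snd (a1 + s * b1, a2 + s * b2, a3 + s * b3)) +
      \<omega> ^ 2 * fst (a1 + s * b1, a2 + s * b2, a3 + s * b3)) * conic_disc (2 * m) m (a1 + s * b1, a2 + s * b2, a3 + s * b3))"
    unfolding fst_conv snd_conv by (intro plane_poly_intros plane_poly_conic_disc)
next
  show "hom_poly {..7} (\<lambda>_. 1) 1 (\<lambda>y. y 3 :: 'k)" "hom_poly {..7} (\<lambda>_. 1) 1 (\<lambda>y. y 4 :: 'k)"
      "hom_poly {..7} (\<lambda>_. 1) 1 (\<lambda>y. y 5 :: 'k)" "hom_poly {..7} (\<lambda>_. 1) 1 (\<lambda>y. \<omega> * y 4 + \<omega> ^ 2 * y 3)"
      "hom_poly {..7} (\<lambda>_. 1) 1 (\<lambda>y. - (y 3 + \<omega> ^ 2 * y 5))"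
    by (intro hom_var hom_poly_scale hom_poly_add hom_poly_uminus; simp)+
qed (use m in simp_all)

text \<open>The right-hand side is, apart from \<open>p q\<close>, linear in \<open>(p, q)\<close>.  So for given \<open>u\<close> at most one point of
the line \<open>v\<^sub>1 = 0\<close> off the coordinate points fails to be usable, unless both coefficients are zero.\<close>

lemma polar_base_point:
  fixes l m \<omega> :: "'k::field"
  assumes \<omega>: "\<omega> ^ 2 + \<omega> + 1 = 0"
  shows "polar (- l) m (0, p, q) (0, - \<omega> * p, q) (u1, u2, u3) = p * q *
    ((- (3 * l + 6 * m) * \<omega> * u1 - 4 * m * (\<omega> ^ 2 - \<omega>) * (u1 + \<omega> * u3)) * p
     + ((6 * m - 3 * l) * u1 - 4 * m * (\<omega> ^ 2 - \<omega>) * (u2 + \<omega> * u1)) * q)"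
  unfolding polar_def add_Pair biquad.simps Let_def using \<omega> by algebra

lemma biquad_base_point:
  fixes l m \<omega> :: "'k::field"
  assumes \<omega>: "\<omega> ^ 2 + \<omega> + 1 = 0"
  shows "biquad (- l) m (0, p, q) (0, - \<omega> * p, q) = 0"
  unfolding biquad.simps Let_def using \<omega> by algebra

text \<open>The point \<open>u\<close> is the residual intersection of the conic in \<open>u\<close> given by \<open>v\<^sub>0 = (0, p, q)\<close> with the line
through \<open>(0, -\<omega> p, q)\<close> and an arbitrary point; taking \<open>u\<close> itself for that point reaches \<open>u\<close>, if the
polar form is nonzero.  The factors of \<open>h\<close> after the discriminant ensure this: the second and third say
that \<open>p\<close> and \<open>q\<close> are nonzero, and the last one is the resultant of the binary quadratic form in
\<open>(p, q)\<close> with the linear form \<open>M p + N q\<close> of \<open>polar_base_point\<close>.\<close>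

lemma parametrization_generic:
  fixes l m \<omega> :: "'k::{alg_closed_field,field_char_0}"
  assumes m: "m \<noteq> 0" and lm: "l ^ 2 \<noteq> 4 * m ^ 2" and \<omega>: "\<omega> ^ 2 + \<omega> + 1 = 0"
  defines "B \<equiv> \<lambda>y. biquad (- l) m (0, y 6, y 7) (y 3, y 4, y 5)"
    and "C \<equiv> \<lambda>y. - polar (- l) m (0, y 6, y 7) (0, - \<omega> * y 6, y 7) (y 3, y 4, y 5)"
    and "M \<equiv> \<lambda>u1 u3. - (3 * l + 6 * m) * \<omega> * u1 - 4 * m * (\<omega> ^ 2 - \<omega>) * (u1 + \<omega> * u3)"
    and "N \<equiv> \<lambda>u1 u2. (6 * m - 3 * l) * u1 - 4 * m * (\<omega> ^ 2 - \<omega>) * (u2 + \<omega> * u1)"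
  shows "coble_parametrization l m (\<lambda>y. B y * 0 + C y * y 3) (\<lambda>y. B y * (- \<omega> * y 6) + C y * y 4) (\<lambda>y. B y * y 7 + C y * y 5)
    (\<lambda>y. y 6) (\<lambda>y. y 7)
    (\<lambda>(u1, u2, u3). conic_disc l m (u1, u2, u3) * biquad l m (u1, u2, u3) (0, 1, 0) * biquad l m (u1, u2, u3) (0, 0, 1)
       * biquad l m (u1, u2, u3) (0, N u1 u2, - M u1 u3)) 5"
    (is "coble_parametrization l m ?u1 ?u2 ?u3 _ _ ?h 5")
proof
  \<comment> \<open>The resultant vanishes at the first test point for \<open>3 l = 2 m\<close> and at the second for \<open>3 l = - 2 m\<close>.\<close>
  have d1: "conic_disc l m (1, 1, 0) = 36 * m * (l ^ 2 - 4 * m ^ 2)"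
    "conic_disc l m (1, 0, 1) = 36 * m * (l ^ 2 - 4 * m ^ 2)"
    by (simp_all add: conic_disc_def Let_def polar_def, algebra+)
  have d2: "biquad l m (1, 1, 0) (0, 1, 0) = - 4 * m" "biquad l m (1, 1, 0) (0, 0, 1) = - 4 * m"
    "biquad l m (1, 0, 1) (0, 1, 0) = - 4 * m" "biquad l m (1, 0, 1) (0, 0, 1) = - 4 * m"
    by simp_all
  have d3: "biquad l m (1, 1, 0) (0, N 1 1, - M 1 0) = - 9 * \<omega> * (3 * l - 2 * m) * (l ^ 2 - 4 * m ^ 2)"
    "biquad l m (1, 0, 1) (0, N 1 0, - M 1 1) = 9 * \<omega> * (3 * l + 2 * m) * (l ^ 2 - 4 * m ^ 2)"
    unfolding M_def N_def biquad.simps Let_def by (use \<omega> in algebra)+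
  have nz: "\<omega> \<noteq> 0" "l ^ 2 - 4 * m ^ 2 \<noteq> 0"
    using \<omega> lm by auto
  have "?h (1, 1, 0) \<noteq> 0 \<or> ?h (1, 0, 1) \<noteq> 0"
  proof (cases "3 * l - 2 * m = 0")
    case True
    have "3 * l + 2 * m \<noteq> 0"
    proof
      assume "3 * l + 2 * m = 0"
      with True have "4 * m = 0" by algebra
      then show False using m by simp
    qed
    then have "?h (1, 0, 1) \<noteq> 0"
      unfolding prod.case d1 d2 d3 mult_eq_0_iff using m nz by simp
    then show ?thesis ..
  next
    case False
    then have "?h (1, 1, 0) \<noteq> 0"
      unfolding prod.case d1 d2 d3 mult_eq_0_iff using m nz by simp
    then show ?thesis ..
  qed
  then show "\<exists>u. ?h u \<noteq> 0"
    by blast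
  have B: "hom_poly {..7} (\<lambda>_. 1) 4 B"
    unfolding B_def by (intro hom_poly_biquad[where d = 1 and e = 1] hom_poly_zero hom_var) simp_all
  have C: "hom_poly {..7} (\<lambda>_. 1) 4 C"
    unfolding C_def
    by (intro hom_poly_uminus hom_poly_polar[where d = 1 and e = 1] hom_poly_zero hom_poly_scale hom_var) simp_all
  show "hom_poly {..7} (\<lambda>_. 1) 5 ?u1" "hom_poly {..7} (\<lambda>_. 1) 5 ?u2" "hom_poly {..7} (\<lambda>_. 1) 5 ?u3"
    by (intro hom_poly_add hom_poly_mult[OF B, of 1] hom_poly_mult[OF C, of 1] hom_poly_zero hom_poly_scale hom_var; simp)+
  show "hom_poly {..7} (\<lambda>_. 1) 1 (\<lambda>y. y 6 :: 'k)" "hom_poly {..7} (\<lambda>_. 1) 1 (\<lambda>y. y 7 :: 'k)"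
    by (rule hom_var; simp)+
  have U: "(?u1 y, ?u2 y, ?u3 y) = smul (B y) (0, - \<omega> * y 6, y 7) + smul (C y) (y 3, y 4, y 5)" for y
    by simp
  show "biquad l m (?u1 y, ?u2 y, ?u3 y) (0, y 6, y 7) = 0" for y
    unfolding biquad_swap[of l m _ "(0, y 6, y 7)"] U biquad_combine biquad_base_point[OF \<omega>]
    by (simp add: B_def C_def power2_eq_square)
  show "plane_poly (\<lambda>s z. ?h (a1 + s * b1, a2 + s * b2, a3 + s * b3))" for a1 a2 a3 b1 b2 b3
    unfolding prod.case M_def N_def by (intro plane_poly_intros plane_poly_conic_disc plane_poly_biquad)
  show "conic_disc l m u \<noteq> 0" if "?h u \<noteq> 0" for u
    using that by (cases u) simp
  show "l \<noteq> 0 \<or> m \<noteq> 0"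
    using m by simp
  fix u :: "'k triple" and w1 w2 w3 :: 'k
  assume h: "?h u \<noteq> 0"
  obtain a1 a2 a3 where u: "u = (a1, a2, a3)"
    by (metis prod_cases3)
  let ?G = "\<lambda>p q. biquad l m (a1, a2, a3) (0, p, q)"
  have nz: "?G 1 0 \<noteq> 0" "?G 0 1 \<noteq> 0" "?G (N a1 a2) (- M a1 a3) \<noteq> 0"
    using h unfolding u prod.case by auto
  have G: "?G p q = ?G 1 0 * p ^ 2 + polar l m (a1, a2, a3) (0, 1, 0) (0, 0, 1) * (p * q) + ?G 0 1 * q ^ 2" for p q
    using biquad_expand[of l m "(a1, a2, a3)" 0 p q] by (simp del: biquad.simps add: mult_ac)
  obtain p where p: "?G p 1 = 0"
    using quadratic_root[OF nz(1)] G[of _ 1] by (metis mult.right_neutral power_one)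
  have "p \<noteq> 0"
    using p nz(2) by auto
  define y where "y = params (w1, w2, w3) (a1, a2, a3) p 1"
  have "M a1 a3 * p + N a1 a2 \<noteq> 0"
  proof
    assume "M a1 a3 * p + N a1 a2 = 0"
    then have "N a1 a2 = - M a1 a3 * p"
      by (simp add: eq_neg_iff_add_eq_0 add.commute)
    then have "?G (N a1 a2) (- M a1 a3) = M a1 a3 ^ 2 * ?G p 1"
      unfolding G[of "N a1 a2"] G[of p 1] by (simp add: algebra_simps power2_eq_square)
    then show False
      using p nz(3) by simp
  qed
  then have C_nz: "C y \<noteq> 0"
    using \<open>p \<noteq> 0\<close> unfolding C_def y_def polar_base_point[OF \<omega>] M_def N_def by simp
  have "B y = 0"
    using p biquad_swap[of l m "(a1, a2, a3)"] unfolding B_def y_def by (simp del: biquad.simps)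
  then have "(?u1 y, ?u2 y, ?u3 y) = smul (C y) u"
    unfolding u by (simp add: y_def)
  moreover have "\<forall>i. i \<notin> {..7} \<longrightarrow> y i = 0" "(y 0, y 1, y 2) = (w1, w2, w3)" "(y 6, y 7) \<noteq> (0, 0)"
    unfolding y_def by (simp_all add: params_supp)
  ultimately show "\<exists>(y :: nat \<Rightarrow> 'k) c. (\<forall>i. i \<notin> {..7} \<longrightarrow> y i = 0) \<and> c \<noteq> 0 \<and> (y 0, y 1, y 2) = (w1, w2, w3) \<and>
      (?u1 y, ?u2 y, ?u3 y) = smul c u \<and> (y 6, y 7) \<noteq> (0, 0)"
    using C_nz by blast
qed

lemma parametrization_exists:
  fixes l m :: "'k::{alg_closed_field,field_char_0}"
  assumes "l \<noteq> 0 \<or> m \<noteq> 0" "m = 0 \<or> l = 2 * m \<or> l ^ 2 \<noteq> 4 * m ^ 2"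
  shows "\<exists>u1 u2 u3 p q h e. coble_parametrization l m u1 u2 u3 p q h e"
proof -
  obtain \<omega> :: 'k where "\<omega> ^ 2 + \<omega> + 1 = 0"
    using quadratic_root[of 1 1 1] by auto
  then show ?thesis
    using assms parametrization_igusa[of l] parametrization_burkhardt[of m \<omega>] parametrization_generic[of m l \<omega>]
    by blast
qed

section \<open>Points with nonzero triple sums are dense\<close>

text \<open>Functions that become polynomials on every polynomially parametrized surface.  Unlike the forms
themselves, they can be multiplied by sums of coordinates without a change of representation.\<close>

definition polyfun :: "((nat \<Rightarrow> 'k::field) \<Rightarrow> 'k) \<Rightarrow> bool" where
  "polyfun f \<longleftrightarrow> (\<forall>X. (\<forall>i. plane_poly (\<lambda>s z. X s z i)) \<longrightarrow> plane_poly (\<lambda>s z. f (X s z)))"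

lemma polyfun_mpol_eval: "polyfun (mpol_eval (F :: 'k::field_char_0 mpol))"
  unfolding polyfun_def by (auto intro: plane_poly_mpol_eval)

lemma polyfun_sum_mult:
  fixes f :: "(nat \<Rightarrow> 'k::field_char_0) \<Rightarrow> 'k"
  shows "polyfun f \<Longrightarrow> polyfun (\<lambda>x. sum x S * f x)"
  unfolding polyfun_def by (auto intro!: plane_poly_intros plane_poly_sum)

lemma triplesE:
  assumes "S \<in> triples"
  obtains i j k l m n where "S = {i, j, k}" "{1..6} - S = {l, m, n}" "{1..6} = {i, j, k, l, m, n}"
    "distinct [i, j, k, l, m, n]" "{l, m, n} \<in> triples"
proof -
  have S: "S \<subseteq> {1..6}" "card S = 3"
    using assms by (auto simp: triples_def)
  then have T: "card ({1..6} - S) = 3"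
    by (simp add: card_Diff_subset finite_subset)
  obtain i j k where ijk: "S = {i, j, k}" "i \<noteq> j" "j \<noteq> k" "i \<noteq> k"
    using S(2) by (auto simp: card_3_iff)
  obtain l m n where lmn: "{1..6} - S = {l, m, n}" "l \<noteq> m" "m \<noteq> n" "l \<noteq> n"
    using T by (auto simp: card_3_iff)
  have all: "{1..6} = {i, j, k, l, m, n}"
    using S(1) lmn(1) ijk(1) by blast
  have "{l, m, n} \<inter> {i, j, k} = {}"
    using lmn(1) ijk(1) by blast
  then have dist: "distinct [i, j, k, l, m, n]"
    using ijk lmn by auto
  have "{l, m, n} \<in> triples"
    using T lmn(1) by (auto simp: triples_def)
  then show thesis
    using that ijk(1) lmn(1) all dist by blast
qed

text \<open>The triple sums are removed one at a time.\<close>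

lemma vanishing_off_triple_sums:
  fixes f :: "(nat \<Rightarrow> 'k::field_char_0) \<Rightarrow> 'k"
  assumes step: "\<And>S f x. S \<in> triples \<Longrightarrow> polyfun f \<Longrightarrow> (\<And>x. x \<in> K \<Longrightarrow> sum x S * f x = 0) \<Longrightarrow> x \<in> K \<Longrightarrow> f x = 0"
    and f: "polyfun f" and van: "\<And>x. x \<in> K \<Longrightarrow> (\<And>S. S \<in> triples \<Longrightarrow> sum x S \<noteq> 0) \<Longrightarrow> f x = 0"
    and x: "x \<in> K"
  shows "f x = 0"
proof -
  have "finite triples"
    by (rule finite_subset[of _ "Pow {1..6}"]) (auto simp: triples_def)
  have main: "f x = 0" if "finite T" "T \<subseteq> triples" "polyfun f" "\<forall>x\<in>K. (\<forall>S\<in>T. sum x S \<noteq> 0) \<longrightarrow> f x = 0" "x \<in> K" for T f x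
    using that
  proof (induction T arbitrary: f x)
    case (insert S T)
    have "sum x S * f x = 0" if "x \<in> K" for x
      using insert.prems insert.IH[of "\<lambda>x. sum x S * f x" x] polyfun_sum_mult that by auto
    then show ?case
      using step insert.prems by blast
  qed simp
  then show ?thesis
    using main[OF \<open>finite triples\<close> subset_refl f _ x] van by simp
qed

definition quartic_cone :: "'k::field \<Rightarrow> (nat \<Rightarrow> 'k) set" where
  "quartic_cone t = {x. (\<Sum>i=1..6. x i) = 0 \<and> (\<Sum>i=1..6. x i ^ 4) - t * (\<Sum>i=1..6. x i ^ 2) ^ 2 = 0}"

text \<open>The curve is the section of the cone by the plane through \<open>x\<close> with directions \<open>d\<close> and \<open>e\<close>.  The direction
\<open>d = (1, -1, 0; \<iota>, -\<iota>, 0)\<close>, with \<open>\<iota>\<^sup>2 = -1\<close>, leaves the triple sum unchanged, and it satisfies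
\<open>\<Sum> d\<^sub>a\<^sup>2 = 0\<close> and \<open>\<Sum> d\<^sub>a\<^sup>4 = 4\<close>: for every \<open>t\<close> the quartic equation has degree four along \<open>d\<close>.\<close>

lemma quartic_cone_step:
  fixes f :: "(nat \<Rightarrow> 'k::{alg_closed_field,field_char_0}) \<Rightarrow> 'k"
  assumes S: "S \<in> triples" and f: "polyfun f"
    and van: "\<And>x. x \<in> quartic_cone t \<Longrightarrow> sum x S * f x = 0" and x: "x \<in> quartic_cone t"
  shows "f x = 0"
proof -
  obtain i j k l m n where S_eq: "S = {i, j, k}" and all: "{1..6} = {i, j, k, l, m, n}"
      and dist: "distinct [i, j, k, l, m, n]"
    using triplesE[OF S] by metis
  obtain \<iota> :: 'k where "1 * \<iota> ^ 2 + 0 * \<iota> + 1 = 0"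
    using quadratic_root[of 1 0 1] by auto
  then have \<iota>: "\<iota> ^ 2 = - 1"
    by (simp add: eq_neg_iff_add_eq_0)
  have sum6: "(\<Sum>a=1..6. g a) = g i + g j + g k + g l + g m + g n" for g :: "nat \<Rightarrow> 'k"
    using dist unfolding all by (simp add: add.assoc)
  have sum3: "sum g S = g i + g j + g k" for g :: "nat \<Rightarrow> 'k"
    using dist unfolding S_eq by (simp add: add.assoc)
  define d where "d a = (if a = i then 1 else if a = j then - 1 else if a = l then \<iota> else if a = m then - \<iota> else 0)" for a
  define e :: "nat \<Rightarrow> 'k" where "e a = (if a = i then 1 else if a = l then - 1 else 0)" for a
  have d: "d i = 1" "d j = - 1" "d k = 0" "d l = \<iota>" "d m = - \<iota>" "d n = 0"
    and e: "e i = 1" "e j = 0" "e k = 0" "e l = - 1" "e m = 0" "e n = 0"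
    using dist by (auto simp: d_def e_def)
  define X where "X s z a = x a + s * e a + z * d a" for s z a
  define P where "P s z = (\<Sum>a=1..6. X s z a ^ 4) - t * (\<Sum>a=1..6. X s z a ^ 2) ^ 2" for s z
  have cone: "X s z \<in> quartic_cone t" if "P s z = 0" for s z
    using that x unfolding quartic_cone_def P_def mem_Collect_eq sum6 by (simp add: X_def d e algebra_simps)
  have X: "plane_poly (\<lambda>s z. X s z a)" for a
    unfolding X_def by (intro plane_poly_intros)
  have h: "sum (X s z) S = sum x S + s" for s z
    unfolding sum3 by (simp add: X_def d e)
  \<comment> \<open>The fourth difference of a quartic polynomial is \<open>24\<close> times its leading coefficient.\<close>
  have "P 0 2 - 4 * P 0 1 + 6 * P 0 0 - 4 * P 0 (- 1) + P 0 (- 2) = 96"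
    unfolding P_def sum6 X_def d e using \<iota> by algebra
  then have "\<exists>z1. P 0 z1 \<noteq> 0"
    by (metis diff_zero mult_zero_right add_0 zero_neq_numeral)
  then obtain z1 where z1: "P 0 z1 \<noteq> 0" ..
  have "f (X 0 0) = 0"
  proof (rule density_along_plane_curve[where P = P and h = "\<lambda>s z. sum (X s z) S" and f = "\<lambda>s z. f (X s z)"
        and ?s1.0 = "1 - sum x S" and ?z1.0 = z1 and ?z0.0 = 0])
    show "plane_poly P"
      unfolding P_def by (intro plane_poly_intros plane_poly_sum X)
    show "plane_poly (\<lambda>s z. f (X s z))"
      using f X unfolding polyfun_def by blast
    show "plane_poly (\<lambda>s z. sum (X s z) S)"
      by (intro plane_poly_sum X)
    show "P 0 0 = 0"
      using x by (simp add: P_def X_def quartic_cone_def)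
    show "sum (X s z) S * f (X s z) = 0" if "P s z = 0" for s z
      using van cone that by blast
  qed (use h z1 in auto)
  moreover have "X 0 0 = x"
    by (simp add: X_def fun_eq_iff)
  ultimately show ?thesis
    by simp
qed

definition infinity_cone :: "(nat \<Rightarrow> 'k::field) set" where
  "infinity_cone = {x. (\<Sum>i=1..6. x i) = 0 \<and> (\<Sum>i=1..6. x i ^ 2) = 0 \<and>
     x 0 ^ 2 = (\<Sum>i=1..6. x i ^ 4) - 1 / 4 * (\<Sum>i=1..6. x i ^ 2) ^ 2}"

text \<open>Here the curve must stay in the quadric \<open>\<Sum> x\<^sub>a\<^sup>2 = 0\<close>.  Reflect the points \<open>Y = x + s e\<close> into it along the
isotropic vector \<open>d = (1, \<omega>, \<omega>\<^sup>2; 0, 0, 0)\<close>: the second intersection of the quadric with the line through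
\<open>Y\<close> and \<open>d\<close> is a polynomial in \<open>s\<close>, and for \<open>s = 0\<close> it is \<open>x\<close> itself, provided that \<open>x\<close> is
not orthogonal to \<open>d\<close>.  Over this curve \<open>z = x\<^sub>0\<close> satisfies a monic quadratic equation.\<close>

lemma infinity_cone_curve:
  fixes f :: "(nat \<Rightarrow> 'k::{alg_closed_field,field_char_0}) \<Rightarrow> 'k"
  assumes all: "{1..6} = {i, j, k, l, m, n}" and dist: "distinct [i, j, k, l, m, n]"
    and \<omega>: "\<omega> ^ 2 + \<omega> + 1 = 0" and b: "x i + \<omega> * x j + \<omega> ^ 2 * x k \<noteq> 0"
    and zero: "x i + x j + x k = 0" and f: "polyfun f"
    and van: "\<And>x. x \<in> infinity_cone \<Longrightarrow> (x i + x j + x k) * f x = 0" and x: "x \<in> infinity_cone"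
  shows "f x = 0"
proof -
  have sum6: "(\<Sum>a=1..6. g a) = g i + g j + g k + g l + g m + g n" for g :: "nat \<Rightarrow> 'k"
    using dist unfolding all by (simp add: add.assoc)
  have "0 \<notin> {i, j, k, l, m, n}"
    unfolding all[symmetric] by simp
  then have not0: "i \<noteq> 0" "j \<noteq> 0" "k \<noteq> 0" "l \<noteq> 0" "m \<noteq> 0" "n \<noteq> 0"
    by auto
  define b where "b = x i + \<omega> * x j + \<omega> ^ 2 * x k"
  define d where "d a = (if a = i then 1 else if a = j then \<omega> else if a = k then \<omega> ^ 2 else 0)" for a
  define e :: "nat \<Rightarrow> 'k" where "e a = (if a = i then 1 else if a = l then - 1 else 0)" for a
  have d: "d i = 1" "d j = \<omega>" "d k = \<omega> ^ 2" "d l = 0" "d m = 0" "d n = 0"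
    and e: "e i = 1" "e j = 0" "e k = 0" "e l = - 1" "e m = 0" "e n = 0"
    using dist by (auto simp: d_def e_def)
  define r where "r = 1 / (2 * b)"
  have "b \<noteq> 0"
    using assms(4) unfolding b_def .
  then have br: "2 * b * r = 1"
    by (simp add: r_def)
  define Y where "Y s a = x a + s * e a" for s a
  define X where "X s z a = (if a = 0 then z else r * (2 * (b + s) * Y s a - (\<Sum>a=1..6. Y s a ^ 2) * d a))" for s z a
  define P where "P s z = z ^ 2 - (\<Sum>a=1..6. X s z a ^ 4)" for s z
  have Xa: "X s z a = r * (2 * (b + s) * Y s a - (\<Sum>a=1..6. Y s a ^ 2) * d a)" if "a \<noteq> 0" for s z a
    using that by (simp add: X_def)
  have "1 + \<omega> + \<omega> ^ 2 = 0" "1 + \<omega> ^ 2 + (\<omega> ^ 2) ^ 2 = 0"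
    by (use \<omega> in algebra)+
  then have sumd: "d i + d j + d k = 0" "d i ^ 2 + d j ^ 2 + d k ^ 2 + d l ^ 2 + d m ^ 2 + d n ^ 2 = 0"
    unfolding d by simp_all
  have sumY: "Y s i + Y s j + Y s k + Y s l + Y s m + Y s n = 0" "Y s i + Y s j + Y s k = s" for s
  proof -
    have "x i + x j + x k + x l + x m + x n = 0"
      using x unfolding infinity_cone_def mem_Collect_eq sum6 by blast
    then have "x l + x m + x n = 0"
      using zero by simp
    then show "Y s i + Y s j + Y s k + Y s l + Y s m + Y s n = 0" "Y s i + Y s j + Y s k = s"
      using zero unfolding Y_def e by algebra+
  qed
  have Yd: "Y s i * d i + Y s j * d j + Y s k * d k + Y s l * d l + Y s m * d m + Y s n * d n = b + s" for s
    by (simp add: Y_def d e b_def algebra_simps)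
  have h: "X s z i + X s z j + X s z k = 2 * r * (b + s) * s" for s z
  proof -
    have "X s z i + X s z j + X s z k = 2 * r * (b + s) * (Y s i + Y s j + Y s k) - r * (\<Sum>a=1..6. Y s a ^ 2) * (d i + d j + d k)"
      unfolding Xa[OF not0(1)] Xa[OF not0(2)] Xa[OF not0(3)] by (simp add: algebra_simps)
    then show ?thesis
      unfolding sumd sumY by simp
  qed
  have X1: "(\<Sum>a=1..6. X s z a) = 0" for s z
  proof -
    have "(\<Sum>a=1..6. X s z a) = 2 * r * (b + s) * (Y s i + Y s j + Y s k + Y s l + Y s m + Y s n)
        - r * (\<Sum>a=1..6. Y s a ^ 2) * (d i + d j + d k)"
      unfolding sum6[of "X s z"] Xa[OF not0(1)] Xa[OF not0(2)] Xa[OF not0(3)] Xa[OF not0(4)] Xa[OF not0(5)] Xa[OF not0(6)]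
      by (simp add: algebra_simps d)
    then show ?thesis
      unfolding sumd(1) sumY(1) by simp
  qed
  have X2: "(\<Sum>a=1..6. X s z a ^ 2) = 0" for s z
  proof -
    define q where "q = (\<Sum>a=1..6. Y s a ^ 2)"
    have "(\<Sum>a=1..6. X s z a ^ 2) = r ^ 2 * (4 * (b + s) ^ 2 * (Y s i ^ 2 + Y s j ^ 2 + Y s k ^ 2 + Y s l ^ 2 + Y s m ^ 2 + Y s n ^ 2)
       - 4 * (b + s) * q * (Y s i * d i + Y s j * d j + Y s k * d k + Y s l * d l + Y s m * d m + Y s n * d n)
       + q ^ 2 * (d i ^ 2 + d j ^ 2 + d k ^ 2 + d l ^ 2 + d m ^ 2 + d n ^ 2))"
      unfolding sum6[of "\<lambda>a. X s z a ^ 2"] Xa[OF not0(1)] Xa[OF not0(2)] Xa[OF not0(3)] Xa[OF not0(4)] Xa[OF not0(5)] Xa[OF not0(6)]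
        q_def[symmetric] by algebra
    also have "\<dots> = 0"
      unfolding Yd sumd sum6[of "\<lambda>a. Y s a ^ 2", symmetric] q_def[symmetric] by (simp add: power2_eq_square)
    finally show ?thesis .
  qed
  have cone: "X s z \<in> infinity_cone" if "P s z = 0" for s z
    using that X1[of s z] X2[of s z] unfolding infinity_cone_def P_def by (simp add: X_def)
  have X: "plane_poly (\<lambda>s z. X s z a)" for a
  proof (cases "a = 0")
    case True
    show ?thesis
      unfolding X_def if_P[OF True] by (intro plane_poly_intros)
  next
    case False
    show ?thesis
      unfolding X_def if_not_P[OF False] Y_def by (intro plane_poly_intros plane_poly_sum)
  qed
  have base: "X 0 z a = x a" if "a \<noteq> 0" for z a
  proof -
    have "X 0 z a = (2 * b * r) * x a"
      using that x unfolding Xa[OF that] infinity_cone_def by (simp add: Y_def algebra_simps)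
    then show ?thesis
      unfolding br by simp
  qed
  have base0: "X 0 (x 0) = x"
    using base by (auto simp: fun_eq_iff X_def)
  have P0: "P 0 z = z ^ 2 - (\<Sum>a=1..6. x a ^ 4)" for z
    unfolding P_def by (simp add: base)
  have "P 0 1 - P 0 0 = 1"
    unfolding P0 by simp
  then obtain z1 where z1: "P 0 z1 \<noteq> 0"
    by fastforce
  have "f (X 0 (x 0)) = 0"
  proof (rule density_along_plane_curve[where P = P and h = "\<lambda>s z. X s z i + X s z j + X s z k" and f = "\<lambda>s z. f (X s z)"
        and ?s1.0 = b and ?z1.0 = z1 and ?z0.0 = "x 0"])
    show "plane_poly P"
      unfolding P_def by (intro plane_poly_intros plane_poly_sum X)
    show "plane_poly (\<lambda>s z. f (X s z))"
      using f X unfolding polyfun_def by blast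
    show "plane_poly (\<lambda>s z. X s z i + X s z j + X s z k)"
      by (intro plane_poly_intros X)
    show "P 0 (x 0) = 0"
      unfolding P0 using x by (simp add: infinity_cone_def)
    show "(X s z i + X s z j + X s z k) * f (X s z) = 0" if "P s z = 0" for s z
      using van cone that by blast
    have "2 * r * (b + b) * b = 2 * b"
      using br by algebra
    then show "X b 0 i + X b 0 j + X b 0 k \<noteq> 0"
      unfolding h using \<open>b \<noteq> 0\<close> by (metis mult_eq_0_iff zero_neq_numeral)
  qed (use h z1 in auto)
  then show ?thesis
    unfolding base0 .
qed

text \<open>Together with the sum, the two expressions are the discrete Fourier transform of \<open>(x1, x2, x3)\<close>.\<close>

lemma fourier_nonzero:
  fixes x1 x2 x3 \<omega> :: "'k::field_char_0"
  assumes "\<omega> ^ 2 + \<omega> + 1 = 0" "x1 + x2 + x3 = 0" "x1 \<noteq> 0 \<or> x2 \<noteq> 0 \<or> x3 \<noteq> 0"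
  shows "x1 + \<omega> * x2 + \<omega> ^ 2 * x3 \<noteq> 0 \<or> x1 + \<omega> ^ 2 * x2 + (\<omega> ^ 2) ^ 2 * x3 \<noteq> 0"
proof (rule ccontr)
  assume "\<not> ?thesis"
  then have "x1 + \<omega> * x2 + \<omega> ^ 2 * x3 = 0" "x1 + \<omega> ^ 2 * x2 + (\<omega> ^ 2) ^ 2 * x3 = 0"
    by auto
  note eqs = this assms(1,2)
  have "3 * x1 = 0" "3 * x2 = 0" "3 * x3 = 0"
    by (use eqs in algebra)+
  then show False
    using assms(3) by simp
qed

text \<open>By \<open>fourier_nonzero\<close>, applied to the three coordinates in \<open>S\<close> or to the other three, one of four isotropic
vectors is not orthogonal to \<open>x\<close>.  At the origin all of them are, so it is excluded.\<close>

lemma infinity_cone_step: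
  fixes f :: "(nat \<Rightarrow> 'k::{alg_closed_field,field_char_0}) \<Rightarrow> 'k"
  assumes S: "S \<in> triples" and f: "polyfun f"
    and van: "\<And>x. x \<in> infinity_cone \<inter> {x. \<exists>i\<in>{1..6}. x i \<noteq> 0} \<Longrightarrow> sum x S * f x = 0"
    and x: "x \<in> infinity_cone \<inter> {x. \<exists>i\<in>{1..6}. x i \<noteq> 0}"
  shows "f x = 0"
proof (cases "sum x S = 0")
  case True
  obtain i j k l m n where S_eq: "S = {i, j, k}" and all: "{1..6} = {i, j, k, l, m, n}"
      and dist: "distinct [i, j, k, l, m, n]"
    using triplesE[OF S] by metis
  obtain \<omega> :: 'k where \<omega>: "\<omega> ^ 2 + \<omega> + 1 = 0"
    using quadratic_root[of 1 1 1] by auto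
  then have \<omega>': "(\<omega> ^ 2) ^ 2 + \<omega> ^ 2 + 1 = 0"
    by algebra
  have sum6: "(\<Sum>a=1..6. g a) = g i + g j + g k + g l + g m + g n" for g :: "nat \<Rightarrow> 'k"
    using dist unfolding all by (simp add: add.assoc)
  have sum3: "sum g S = g i + g j + g k" for g :: "nat \<Rightarrow> 'k"
    using dist unfolding S_eq by (simp add: add.assoc)
  have van1: "(x i + x j + x k) * f x = 0" if "x \<in> infinity_cone" for x
  proof (cases "\<exists>i\<in>{1..6}. x i \<noteq> 0")
    case True
    then show ?thesis
      using van[of x] that by (simp add: sum3)
  next
    case False
    then have "x i = 0" "x j = 0" "x k = 0"
      unfolding all by auto
    then show ?thesis by simp
  qed
  have van2: "(x l + x m + x n) * f x = 0" if "x \<in> infinity_cone" for x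
  proof -
    have "x l + x m + x n = - (x i + x j + x k)"
      using that unfolding infinity_cone_def mem_Collect_eq sum6 by algebra
    then show ?thesis
      using van1[OF that] by (metis minus_mult_left neg_equal_0_iff_equal)
  qed
  have z1: "x i + x j + x k = 0"
    using True sum3 by simp
  have z2: "x l + x m + x n = 0"
    using x z1 unfolding infinity_cone_def Int_iff mem_Collect_eq sum6 by algebra
  have xc: "x \<in> infinity_cone"
    using x by blast
  have all': "{1..6} = {l, m, n, i, j, k}"
    unfolding all by auto
  have dist': "distinct [l, m, n, i, j, k]"
    using dist by auto
  have "\<exists>a\<in>{i, j, k, l, m, n}. x a \<noteq> 0"
    using x unfolding all by blast
  then consider "x i \<noteq> 0 \<or> x j \<noteq> 0 \<or> x k \<noteq> 0" | "x l \<noteq> 0 \<or> x m \<noteq> 0 \<or> x n \<noteq> 0"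
    by auto
  then show ?thesis
  proof cases
    case 1
    show ?thesis
      using fourier_nonzero[OF \<omega> z1 1] infinity_cone_curve[OF all dist \<omega> _ z1 f van1 xc]
        infinity_cone_curve[OF all dist \<omega>' _ z1 f van1 xc] by blast
  next
    case 2
    show ?thesis
      using fourier_nonzero[OF \<omega> z2 2] infinity_cone_curve[OF all' dist' \<omega> _ z2 f van2 xc]
        infinity_cone_curve[OF all' dist' \<omega>' _ z2 f van2 xc] by blast
  qed
next
  case False
  then show ?thesis
    using van x by auto
qed

section \<open>Unirationality\<close>

lemma mpol_eval_cong:
  assumes "F \<in> whomog I w d" "\<And>i. i \<in> I \<Longrightarrow> x i = y i"
  shows "mpol_eval F x = mpol_eval F y"
proof -
  have "(\<Prod>i\<in>Poly_Mapping.keys m. x i ^ Poly_Mapping.lookup m i) =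
      (\<Prod>i\<in>Poly_Mapping.keys m. y i ^ Poly_Mapping.lookup m i)" if "m \<in> Poly_Mapping.keys F" for m
    using assms that by (intro prod.cong refl) (auto simp: whomog_def subset_iff)
  then show ?thesis
    unfolding mpol_eval_def by (intro sum.cong) auto
qed

text \<open>The point \<open>(1 : 1 : \<omega> : \<omega> : \<omega>\<^sup>2 : \<omega>\<^sup>2)\<close> lies on all the threefolds, since its second and fourth power
sums are zero.  It shows that they are nonempty.\<close>

lemma cyclotomic_node:
  obtains x :: "nat \<Rightarrow> 'k::{alg_closed_field,field_char_0}"
  where "x 0 = 0" "x 1 = 1" "\<And>i. i > 6 \<Longrightarrow> x i = 0"
    "(\<Sum>i=1..6. x i) = 0" "(\<Sum>i=1..6. x i ^ 2) = 0" "(\<Sum>i=1..6. x i ^ 4) = 0"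
proof -
  obtain \<omega> :: 'k where \<omega>: "\<omega> ^ 2 + \<omega> + 1 = 0"
    using quadratic_root[of 1 1 1] by auto
  define x where "x i = (if i = 0 \<or> i > 6 then 0 else if i \<le> 2 then 1 else if i \<le> 4 then \<omega> else \<omega> ^ 2)" for i :: nat
  have x: "x 1 = 1" "x 2 = 1" "x 3 = \<omega>" "x 4 = \<omega>" "x 5 = \<omega> ^ 2" "x 6 = \<omega> ^ 2"
    by (simp_all add: x_def)
  have sums: "(\<Sum>i=1..6. x i) = 0" "(\<Sum>i=1..6. x i ^ 2) = 0" "(\<Sum>i=1..6. x i ^ 4) = 0"
    unfolding sum_1_6 x power_one by (use \<omega> in algebra)+
  show thesis
    by (rule that[of x]) (use x sums in \<open>simp_all add: x_def\<close>)
qed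

lemma unirational_X_infinity:
  "unirational {0..6} weights_2_1 (X_infinity :: (nat \<Rightarrow> 'k::{alg_closed_field,field_char_0}) set set)"
proof -
  obtain u1 u2 u3 p q h e where "coble_parametrization (0::'k) 1 u1 u2 u3 p q h e"
    using parametrization_exists[of "0::'k" 1] by auto
  then interpret coble_parametrization "0::'k" 1 u1 u2 u3 p q h e .
  interpret hom_map 7 "3 * e + 3" "{0..6}" weights_2_1 \<Psi>
    by unfold_locales (use hom_\<Psi> \<Psi>_supp in auto)
  define C where "C x \<longleftrightarrow> (\<Sum>i=1..6. x i) = 0 \<and> (\<Sum>i=1..6. x i ^ 2) = 0 \<and>
        x 0 ^ 2 = (\<Sum>i=1..6. x i ^ 4) - 1 / 4 * (\<Sum>i=1..6. x i ^ 2) ^ 2" for x :: "nat \<Rightarrow> 'k"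
  have C_cone: "C x \<longleftrightarrow> coble_cone 0 1 x" for x
    by (auto simp: C_def coble_cone_def)
  obtain x0 :: "nat \<Rightarrow> 'k" where node: "x0 0 = 0" "x0 1 = 1" "\<And>i. i > 6 \<Longrightarrow> x0 i = 0"
    "(\<Sum>i=1..6. x0 i) = 0" "(\<Sum>i=1..6. x0 i ^ 2) = 0" "(\<Sum>i=1..6. x0 i ^ 4) = 0"
    by (rule cyclotomic_node) blast
  have x0: "x0 \<in> nonzero_vecs {0..6}" "C x0"
    unfolding C_def node using node(1-3) by (auto simp: nonzero_vecs_def intro!: bexI[of _ 1])
  have "unirational {0..6} weights_2_1 {p \<in> wproj {0..6} weights_2_1. \<forall>x\<in>p. C x}"
  proof (rule unirational_of_dense_image)
    show "C (\<Psi> y)" for y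
      unfolding C_cone by (rule \<Psi>_in_cone)
    show "C (wscale weights_2_1 k x)" if "C x" for x k
      using that unfolding C_def wscale_def weights_2_1_def
      by (simp add: power_mult_distrib flip: sum_distrib_left)
    show "x0 \<in> nonzero_vecs {0..6}" "C x0" by (rule x0)+
    fix d F and x :: "nat \<Rightarrow> 'k"
    assume F: "F \<in> whomog {0..6} weights_2_1 d"
      and van: "\<And>y. y \<in> nonzero_vecs {..7} \<Longrightarrow> \<Psi> y \<in> nonzero_vecs {0..6} \<Longrightarrow> mpol_eval F (\<Psi> y) = 0"
      and x: "x \<in> nonzero_vecs {0..6}" "C x"
    let ?K = "infinity_cone \<inter> {x. \<exists>i\<in>{1..6}. x i \<noteq> (0::'k)}"
    show "mpol_eval F x = 0"
    proof (rule vanishing_off_triple_sums[where K = ?K, OF _ polyfun_mpol_eval])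
      show "x \<in> ?K"
      proof (rule ccontr)
        assume "x \<notin> ?K"
        moreover have "x \<in> infinity_cone"
          using x(2) by (simp only: infinity_cone_def C_def mem_Collect_eq)
        ultimately have 0: "\<forall>i\<in>{1..6}. x i = 0"
          by blast
        then have "x 0 = 0"
          using x(2) by (simp add: C_def)
        moreover have "{0..6} = insert 0 {1..6::nat}"
          by auto
        ultimately show False
          using 0 x(1) by (auto simp: nonzero_vecs_def)
      qed
    next
      fix y assume y: "y \<in> ?K" and gen: "\<And>S. S \<in> triples \<Longrightarrow> sum y S \<noteq> 0"
      define z where "z i = (if i \<le> 6 then y i else 0)" for i
      have "mpol_eval F z = 0"
      proof (rule \<Psi>_dense[OF F])
        show "mpol_eval F (\<Psi> y) = 0" if "y \<in> nonzero_vecs {..7}" "\<exists>i\<in>{1..6}. \<Psi> y i \<noteq> 0" for y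
          using that supp by (intro van) (auto simp: nonzero_vecs_def)
        show "coble_cone 0 1 z"
          using y by (auto simp: coble_cone_def infinity_cone_def z_def)
        show "sum z S \<noteq> 0" if "S \<in> triples" for S
        proof -
          have "sum z S = sum y S"
            using that by (intro sum.cong) (auto simp: z_def triples_def)
          then show ?thesis using gen that by simp
        qed
      qed (simp add: z_def)
      then show "mpol_eval F y = 0"
        using mpol_eval_cong[OF F, of y z] by (simp add: z_def)
    next
      fix S f and x :: "nat \<Rightarrow> 'k"
      assume "S \<in> triples" "polyfun f" "\<And>x. x \<in> ?K \<Longrightarrow> sum x S * f x = 0" "x \<in> ?K"
      then show "f x = 0"
        by (rule infinity_cone_step)
    qed
  qed
  then show ?thesis
    unfolding X_infinity_def C_def .
qed

text \<open>Both square roots of \<open>t - 1/4\<close> give the same quartic.  For \<open>t = 1/2\<close> the root \<open>1/2\<close> is chosen, because the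
explicit section was given for \<open>l = 2 m\<close>.  The coordinate \<open>x\<^sub>0\<close> of the Coble fourfold is dropped from the
parametrization, and it is restored as \<open>\<tau> \<Sum> x\<^sub>i\<^sup>2\<close> when a point of the quartic is lifted.\<close>

lemma unirational_quartic_X:
  fixes t :: "'k::{alg_closed_field,field_char_0}"
  shows "unirational {1..6} (\<lambda>_. 1) (quartic_X t)"
proof -
  obtain \<tau>0 where "1 * \<tau>0 ^ 2 + 0 * \<tau>0 + (1 / 4 - t) = 0"
    using quadratic_root[of 1 0 "1 / 4 - t"] by auto
  then have \<tau>0: "\<tau>0 ^ 2 = t - 1 / 4"
    by (simp add: algebra_simps add_eq_0_iff)
  define \<tau> where "\<tau> = (if \<tau>0 = - 1 / 2 then 1 / 2 else \<tau>0)"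
  have \<tau>: "\<tau> ^ 2 = t - 1 / 4"
    using \<tau>0 by (auto simp: \<tau>_def power2_eq_square)
  have "1 + 2 * \<tau> \<noteq> 0"
    by (auto simp: \<tau>_def field_simps add_eq_0_iff)
  moreover have "(1 - 2 * \<tau>) * (1 + 2 * \<tau>) = 1 ^ 2 - 4 * \<tau> ^ 2"
    by (simp add: algebra_simps power2_eq_square)
  ultimately have "\<tau> = 0 \<or> 1 = 2 * \<tau> \<or> 1 ^ 2 \<noteq> 4 * \<tau> ^ 2"
    by (metis eq_iff_diff_eq_0 mult_eq_0_iff)
  then obtain u1 u2 u3 p q h e where "coble_parametrization 1 \<tau> u1 u2 u3 p q h e"
    using parametrization_exists[of 1 \<tau>] by auto
  then interpret coble_parametrization 1 \<tau> u1 u2 u3 p q h e .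
  define \<Phi> where "\<Phi> y i = (if i = 0 then 0 else \<Psi> y i)" for y i
  interpret hom_map 7 "3 * e + 3" "{1..6}" "\<lambda>_. 1" \<Phi>
  proof
    show "hom_poly {..7} (\<lambda>_. 1) ((3 * e + 3) * 1) (\<lambda>y. \<Phi> y j)" if "j \<in> {1..6}" for j
      using hom_\<Psi>[of j] that by (simp add: \<Phi>_def weights_2_1_def)
    show "\<Phi> y j = 0" if "j \<notin> {1..6}" for y j
      using \<Psi>_supp that by (cases "j = 0") (auto simp: \<Phi>_def)
  qed
  define C where "C x \<longleftrightarrow> (\<Sum>i=1..6. x i) = 0 \<and>
      (\<Sum>i=1..6. x i ^ 4) - t * (\<Sum>i=1..6. x i ^ 2) ^ 2 = 0" for x :: "nat \<Rightarrow> 'k"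
  have C_iff: "C x \<longleftrightarrow> x \<in> quartic_cone t" for x
    by (simp add: C_def quartic_cone_def)
  have sum_\<Phi>: "(\<Sum>i=1..6. \<Phi> y i ^ k) = (\<Sum>i=1..6. \<Psi> y i ^ k)" for y k
    by (intro sum.cong) (auto simp: \<Phi>_def)
  obtain x0 :: "nat \<Rightarrow> 'k" where node: "x0 0 = 0" "x0 1 = 1" "\<And>i. i > 6 \<Longrightarrow> x0 i = 0"
    "(\<Sum>i=1..6. x0 i) = 0" "(\<Sum>i=1..6. x0 i ^ 2) = 0" "(\<Sum>i=1..6. x0 i ^ 4) = 0"
    by (rule cyclotomic_node) blast
  have "x0 i = 0" if "i \<notin> {1..6}" for i
    using node(1,3) that by (cases "i = 0") auto
  then have x0: "x0 \<in> nonzero_vecs {1..6}" "C x0"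
    unfolding C_def node using node(2) by (auto simp: nonzero_vecs_def intro!: bexI[of _ 1])
  have "unirational {1..6} (\<lambda>_. 1) {p \<in> wproj {1..6} (\<lambda>_. 1). \<forall>x\<in>p. C x}"
  proof (rule unirational_of_dense_image)
    show "C (\<Phi> y)" for y
    proof -
      have cone: "coble_cone 1 \<tau> (\<Psi> y)"
        by (rule \<Psi>_in_cone)
      then have "(\<Sum>i=1..6. \<Psi> y i ^ 4) - 1 / 4 * (\<Sum>i=1..6. \<Psi> y i ^ 2) ^ 2 = \<tau> ^ 2 * (\<Sum>i=1..6. \<Psi> y i ^ 2) ^ 2"
        unfolding coble_cone_def by (metis mult_1 power_mult_distrib)
      moreover have "(\<Sum>i=1..6. \<Phi> y i) = 0"
        using cone sum_\<Phi>[of y 1] by (simp add: coble_cone_def)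
      ultimately show ?thesis
        unfolding C_def sum_\<Phi> \<tau> by (simp add: algebra_simps)
    qed
    show "C (wscale (\<lambda>_. 1) k x)" if "C x" for x k
      using that unfolding C_def wscale_def
      by (simp add: power_mult_distrib flip: sum_distrib_left)
    show "x0 \<in> nonzero_vecs {1..6}" "C x0" by (rule x0)+
    fix d F and x :: "nat \<Rightarrow> 'k"
    assume F: "F \<in> whomog {1..6} (\<lambda>_. 1) d"
      and van: "\<And>y. y \<in> nonzero_vecs {..7} \<Longrightarrow> \<Phi> y \<in> nonzero_vecs {1..6} \<Longrightarrow> mpol_eval F (\<Phi> y) = 0"
      and x: "x \<in> nonzero_vecs {1..6}" "C x"
    have F': "F \<in> whomog {0..6} weights_2_1 d"
      unfolding whomog_def mem_Collect_eq
    proof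
      fix m assume m: "m \<in> Poly_Mapping.keys F"
      then have sub: "Poly_Mapping.keys m \<subseteq> {1..6}" and
          deg: "(\<Sum>i\<in>Poly_Mapping.keys m. 1 * Poly_Mapping.lookup m i) = d"
        using F by (auto simp: whomog_def)
      have "(\<Sum>i\<in>Poly_Mapping.keys m. weights_2_1 i * Poly_Mapping.lookup m i) = d"
        unfolding deg[symmetric] using sub by (intro sum.cong) (auto simp: weights_2_1_def)
      then show "Poly_Mapping.keys m \<subseteq> {0..6} \<and>
          (\<Sum>i\<in>Poly_Mapping.keys m. weights_2_1 i * Poly_Mapping.lookup m i) = d"
        using sub by auto
    qed
    show "mpol_eval F x = 0"
    proof (rule vanishing_off_triple_sums[where K = "quartic_cone t", OF _ polyfun_mpol_eval])
      show "x \<in> quartic_cone t"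
        using x(2) C_iff by blast
    next
      fix y assume y: "y \<in> quartic_cone t" and gen: "\<And>S. S \<in> triples \<Longrightarrow> sum y S \<noteq> 0"
      define z where "z i = (if i = 0 then \<tau> * (\<Sum>i=1..6. y i ^ 2) else if i \<le> 6 then y i else 0)" for i
      have sum_z: "(\<Sum>i=1..6. z i ^ k) = (\<Sum>i=1..6. y i ^ k)" for k
        by (intro sum.cong) (auto simp: z_def)
      have "mpol_eval F z = 0"
      proof (rule \<Psi>_dense[OF F'])
        fix y :: "nat \<Rightarrow> 'k" assume y: "y \<in> nonzero_vecs {..7}" "\<exists>i\<in>{1..6}. \<Psi> y i \<noteq> 0"
        have "mpol_eval F (\<Phi> y) = 0"
          using y supp by (intro van) (auto simp: nonzero_vecs_def \<Phi>_def)
        then show "mpol_eval F (\<Psi> y) = 0"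
          using mpol_eval_cong[OF F, of "\<Phi> y" "\<Psi> y"] by (simp add: \<Phi>_def)
      next
        have "z 0 ^ 2 = (t - 1 / 4) * (\<Sum>i=1..6. y i ^ 2) ^ 2"
          by (simp add: z_def power_mult_distrib \<tau>)
        moreover have "(\<Sum>i=1..6. z i) = 0"
          using y sum_z[of 1] by (simp add: quartic_cone_def)
        ultimately show "coble_cone 1 \<tau> z"
          unfolding coble_cone_def sum_z using y
          by (simp add: quartic_cone_def left_diff_distrib) (simp add: z_def)
        show "sum z S \<noteq> 0" if "S \<in> triples" for S
        proof -
          have "sum z S = sum y S"
            using that by (intro sum.cong) (auto simp: z_def triples_def)
          then show ?thesis using gen that by simp
        qed
      qed (simp add: z_def)
      then show "mpol_eval F y = 0"
        using mpol_eval_cong[OF F, of y z] by (simp add: z_def)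
    next
      fix S f and x :: "nat \<Rightarrow> 'k"
      assume "S \<in> triples" "polyfun f" "\<And>x. x \<in> quartic_cone t \<Longrightarrow> sum x S * f x = 0" "x \<in> quartic_cone t"
      then show "f x = 0"
        by (rule quartic_cone_step)
    qed
  qed
  then show ?thesis
    unfolding quartic_X_def C_def .
qed

theorem corollary4p2:
  shows "(\<forall>t::'k::{alg_closed_field,field_char_0}. unirational {1..6} (\<lambda>_. 1) (quartic_X t)) \<and>
         unirational {0..6} weights_2_1 (X_infinity :: (nat \<Rightarrow> 'k) set set)"
  using unirational_quartic_X unirational_X_infinity by blast

end
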